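(* Let $N\ge3$, $d>0$, and consider the periodic lattice KPP equation $$\dot u_j(t)=d\bigl(u_{j+1}(t)+u_{j-1}(t)-2u_j(t)\bigr)+f_j(u_j(t)),\qquad j\in\mathbb Z,$$ where $f_{j+N}=f_j$, $f_j(0)=f_j(1)=0$ and $0<f_j(s)\le f_j'(0)s$ for $0<s<1$, under the standard periodic KPP hypotheses, so that the minimal speed of right-moving pulsating fronts and the right spreading speed for compactly supported nontrivial data coincide and, with $V_j=f_j'(0)$, their common value is $$c^*(V)=\inf_{p>0}\frac{\Lambda_p(V)}{p},$$ where $\Lambda_p(V)$ is the principal eigenvalue of the $N$-periodic problem $$(\mathcal L_{p,V}\phi)_j:=d\,(e^{-p}\phi_{j+1}+e^{p}\phi_{j-1}-2\phi_j)+V_j\phi_j=\Lambda_p(V)\phi_j,\qquad \phi_{j+N}=\phi_j,\ \phi_j>0.$$ Then $$c^*(V^\#)\ge c^*(V),$$ where $V^\#$ is the bell-shaped rearrangement of $V=(V_j)_{j\in\mathbb Z/N\mathbb Z}$. Thus, among all cyclic orders (permutations) of a fixed multiset of linear growth rates $V_j$, the bell order maximizes $c^*$, i.e. both the minimal front speed and the spreading speed.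
   Context: A right-moving pulsating front of speed $c$ is a solution $u_j(t)=U(j-ct,j)$ with $U(\xi,j+N)=U(\xi,j)$, $U(-\infty,j)=1$, $U(+\infty,j)=0$. The right spreading speed is the threshold $c^*$ such that solutions with compactly supported nonzero initial data decay on $j\ge ct$ when $c>c^*$ and converge to $1$ on $0\le j\le ct$ when $0<c<c^*$. The identity of both speeds with $\inf_{p>0}\Lambda_p(V)/p$ is known periodic lattice KPP theory and is taken as the characterization of $c^*(V)$; $c^*(V)$ thus depends on the nonlinearity only through $V$. The principal eigenvalue $\Lambda_p(V)$ is the spectral bound of the $N\times N$ matrix of $\mathcal L_{p,V}$ acting on $N$-periodic sequences, the unique eigenvalue with a positive eigenvector. Bell-shaped rearrangement: let $$\rho_N=\begin{cases}(1,2,4,\ldots,2M,\,2M-1,2M-3,\ldots,3),&N=2M,\\(1,2,4,\ldots,2M,\,2M+1,2M-1,\ldots,3),&N=2M+1.\end{cases}$$ For $x\in\mathbb R^N$ with entries listed with multiplicity in decreasing order as $x_{[1]}\ge\cdots\ge x_{[N]}$, the vector $x^\#$ places $x_{[\rho_N(1)]},\ldots,x_{[\rho_N(N)]}$ consecutively around the cycle $\mathbb Z/N\mathbb Z$; rotations and reflections are regarded as equivalent. *)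

theory Defs
  imports "HOL-Analysis.Analysis" "HOL-Library.Multiset"
begin

text \<open>
  Sequences indexed by $\mathbb Z$ are functions on \<^typ>\<open>int\<close>; a vector on the cycle
  $\mathbb Z/N\mathbb Z$ is an $N$-periodic function on \<^typ>\<open>int\<close>.
\<close>

definition periodic :: "nat \<Rightarrow> (int \<Rightarrow> 'a) \<Rightarrow> bool" where
  "periodic N x \<longleftrightarrow> (\<forall>j. x (j + int N) = x j)"


section \<open>The variational speed\<close>

definition tilted_op :: "real \<Rightarrow> real \<Rightarrow> (int \<Rightarrow> real) \<Rightarrow> (int \<Rightarrow> real) \<Rightarrow> (int \<Rightarrow> real)" where
  "tilted_op d p V \<phi> = (\<lambda>j. d * (exp (- p) * \<phi> (j + 1) + exp p * \<phi> (j - 1) - 2 * \<phi> j) + V j * \<phi> j)"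

definition is_principal_eigenvalue :: "real \<Rightarrow> nat \<Rightarrow> real \<Rightarrow> (int \<Rightarrow> real) \<Rightarrow> real \<Rightarrow> bool" where
  "is_principal_eigenvalue d N p V \<Lambda> \<longleftrightarrow>
     (\<exists>\<phi>. periodic N \<phi> \<and> (\<forall>j. \<phi> j > 0) \<and> (\<forall>j. tilted_op d p V \<phi> j = \<Lambda> * \<phi> j))"

definition principal_eigenvalue :: "real \<Rightarrow> nat \<Rightarrow> real \<Rightarrow> (int \<Rightarrow> real) \<Rightarrow> real" where
  "principal_eigenvalue d N p V = (THE \<Lambda>. is_principal_eigenvalue d N p V \<Lambda>)"

text \<open>
  An eigenvalue with a positive eigenvector is the spectral bound of the operator on complex
  $N$-periodic sequences; in particular it is unique.
\<close>

lemma periodic_mod: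
  assumes "periodic N x"
  shows "x (j mod int N) = x j"
proof -
  have add: "x (i + int m * int N) = x i" for i m
  proof (induction m)
    case (Suc m)
    have "x (i + int (Suc m) * int N) = x ((i + int m * int N) + int N)"
      by (simp add: algebra_simps)
    then show ?case using assms Suc by (simp add: periodic_def)
  qed simp
  have dec: "j = j mod int N + (j div int N) * int N" by simp
  show ?thesis
  proof (cases "j div int N \<ge> 0")
    case True
    then show ?thesis using add[of "j mod int N" "nat (j div int N)"] dec by simp
  next
    case False
    then have "j + int (nat (- (j div int N))) * int N = j mod int N"
      using dec by (simp add: algebra_simps)
    then show ?thesis using add[of j "nat (- (j div int N))"] by simp
  qed
qed

lemma is_principal_eigenvalue_spectral_bound:
  fixes \<psi> :: "int \<Rightarrow> complex" and \<mu> :: complex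
  assumes N: "N > 0" and d: "d \<ge> 0" and "is_principal_eigenvalue d N p V \<Lambda>"
    and per: "periodic N \<psi>" and nz: "\<psi> \<noteq> (\<lambda>_. 0)"
    and ev: "\<And>j. of_real d * (of_real (exp (- p)) * \<psi> (j + 1) + of_real (exp p) * \<psi> (j - 1)
                     - 2 * \<psi> j) + of_real (V j) * \<psi> j = \<mu> * \<psi> j"
  shows "Re \<mu> \<le> \<Lambda>"
proof -
  obtain \<phi> where \<phi>: "periodic N \<phi>" "\<And>j. \<phi> j > 0" "\<And>j. tilted_op d p V \<phi> j = \<Lambda> * \<phi> j"
    using assms(3) unfolding is_principal_eigenvalue_def by auto
  define r where "r j = cmod (\<psi> j) / \<phi> j" for j
  have r_per: "periodic N r"
    using per \<phi>(1) unfolding periodic_def r_def by simp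
  have fin: "finite (r ` {0..<int N})" "r ` {0..<int N} \<noteq> {}" using N by auto
  obtain k where k: "k \<in> {0..<int N}" "r k = Max (r ` {0..<int N})"
    using Max_in[OF fin] by (metis imageE)
  have r_le: "r j \<le> r k" for j
  proof -
    have "r (j mod int N) \<in> r ` {0..<int N}" using N by simp
    then have "r (j mod int N) \<le> r k" unfolding k(2) by (rule Max_ge[OF fin(1)])
    then show ?thesis using periodic_mod[OF r_per] by simp
  qed
  have \<psi>_le: "cmod (\<psi> j) \<le> r k * \<phi> j" for j
    using r_le[of j] \<phi>(2)[of j] by (simp add: r_def[of j] pos_divide_le_eq)
  have \<psi>_k: "cmod (\<psi> k) = r k * \<phi> k" using \<phi>(2)[of k] by (simp add: r_def)
  obtain i where "\<psi> i \<noteq> 0" using nz by auto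
  then have "r i > 0" using \<phi>(2)[of i] by (simp add: r_def)
  then have rk: "r k > 0" using r_le[of i] by linarith
  let ?a = "V k - 2 * d"
  have "(\<mu> - of_real ?a) * \<psi> k
      = of_real d * (of_real (exp (- p)) * \<psi> (k + 1) + of_real (exp p) * \<psi> (k - 1))"
    using ev[of k] by (simp add: algebra_simps)
  then have "cmod (\<mu> - of_real ?a) * cmod (\<psi> k)
      = d * cmod (of_real (exp (- p)) * \<psi> (k + 1) + of_real (exp p) * \<psi> (k - 1))"
    using d by (metis norm_mult norm_of_real abs_of_nonneg)
  also have "\<dots> \<le> d * (exp (- p) * cmod (\<psi> (k + 1)) + exp p * cmod (\<psi> (k - 1)))"
    by (intro mult_left_mono order_trans[OF norm_triangle_ineq]) (simp_all add: norm_mult d)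
  also have "\<dots> \<le> d * (exp (- p) * (r k * \<phi> (k + 1)) + exp p * (r k * \<phi> (k - 1)))"
    using d by (intro mult_left_mono add_mono \<psi>_le) auto
  also have "\<dots> = r k * (d * (exp (- p) * \<phi> (k + 1) + exp p * \<phi> (k - 1)))"
    by (simp add: algebra_simps)
  also have "\<dots> = r k * ((\<Lambda> - ?a) * \<phi> k)"
    using \<phi>(3)[of k] unfolding tilted_op_def
    by (intro arg_cong[where f = "(*) (r k)"]) (simp add: algebra_simps)
  also have "\<dots> = (\<Lambda> - ?a) * cmod (\<psi> k)" by (simp add: \<psi>_k)
  finally have "cmod (\<mu> - of_real ?a) \<le> \<Lambda> - ?a"
    using \<psi>_k rk \<phi>(2)[of k] by simp
  moreover have "Re \<mu> - ?a \<le> cmod (\<mu> - of_real ?a)"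
    using complex_Re_le_cmod[of "\<mu> - of_real ?a"] by simp
  ultimately show ?thesis by linarith
qed

lemma is_principal_eigenvalue_unique:
  assumes "N > 0" "d \<ge> 0"
    and "is_principal_eigenvalue d N p V \<Lambda>" "is_principal_eigenvalue d N p V \<Lambda>'"
  shows "\<Lambda> = \<Lambda>'"
proof -
  have le: "b \<le> a"
    if a: "is_principal_eigenvalue d N p V a" and b: "is_principal_eigenvalue d N p V b" for a b
  proof -
    obtain \<phi> where \<phi>: "periodic N \<phi>" "\<And>j. \<phi> j > 0" "\<And>j. tilted_op d p V \<phi> j = b * \<phi> j"
      using b unfolding is_principal_eigenvalue_def by auto
    have "Re (of_real b) \<le> a"
    proof (rule is_principal_eigenvalue_spectral_bound
        [OF assms(1,2) a, of "\<lambda>j. of_real (\<phi> j)"])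
      show "periodic N (\<lambda>j. complex_of_real (\<phi> j))" using \<phi>(1) by (simp add: periodic_def)
      show "(\<lambda>j. complex_of_real (\<phi> j)) \<noteq> (\<lambda>_. 0)"
        using \<phi>(2)[of 0] by (auto simp: fun_eq_iff intro!: exI[of _ 0])
      show "complex_of_real d * (of_real (exp (- p)) * of_real (\<phi> (j + 1))
              + of_real (exp p) * of_real (\<phi> (j - 1)) - 2 * of_real (\<phi> j))
              + of_real (V j) * of_real (\<phi> j) = of_real b * of_real (\<phi> j)" for j
        using arg_cong[OF \<phi>(3)[of j], of complex_of_real] by (simp add: tilted_op_def)
    qed
    then show ?thesis by simp
  qed
  show ?thesis using le[OF assms(3,4)] le[OF assms(4,3)] by linarith
qed

definition cstar :: "real \<Rightarrow> nat \<Rightarrow> (int \<Rightarrow> real) \<Rightarrow> real" where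
  "cstar d N V = (INF p\<in>{0<..}. principal_eigenvalue d N p V / p)"


section \<open>The bell-shaped rearrangement\<close>

text \<open>
  The list $\rho_N = (1,2,4,\dots,5,3)$ of 1-based ranks: $1$, then the even ranks increasing,
  then the odd ranks from $3$ on decreasing.
\<close>

definition bell_order :: "nat \<Rightarrow> nat list" where
  "bell_order N = 1 # filter even [2..<N + 1] @ rev (filter odd [2..<N + 1])"

definition decreasing_entries :: "nat \<Rightarrow> (int \<Rightarrow> real) \<Rightarrow> real list" where
  "decreasing_entries N x = rev (sort (map x [0..int N - 1]))"

definition bell_rearrangement :: "nat \<Rightarrow> (int \<Rightarrow> real) \<Rightarrow> (int \<Rightarrow> real)" where
  "bell_rearrangement N x =
     (\<lambda>j. decreasing_entries N x ! (bell_order N ! nat (j mod int N) - 1))"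

text \<open>Equality up to rotations and reflections of the cycle.\<close>

definition dihedral_equiv :: "(int \<Rightarrow> 'a) \<Rightarrow> (int \<Rightarrow> 'a) \<Rightarrow> bool" where
  "dihedral_equiv x y \<longleftrightarrow> (\<exists>k. (\<forall>j. y j = x (j + k)) \<or> (\<forall>j. y j = x (k - j)))"

definition is_bell_rearrangement :: "nat \<Rightarrow> (int \<Rightarrow> real) \<Rightarrow> (int \<Rightarrow> real) \<Rightarrow> bool" where
  "is_bell_rearrangement N x y \<longleftrightarrow> dihedral_equiv (bell_rearrangement N x) y"

definition same_multiset :: "nat \<Rightarrow> (int \<Rightarrow> real) \<Rightarrow> (int \<Rightarrow> real) \<Rightarrow> bool" where
  "same_multiset N x y \<longleftrightarrow>
     periodic N y \<and> image_mset y (mset_set {0..<int N}) = image_mset x (mset_set {0..<int N})"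


section \<open>The lattice KPP equation, pulsating fronts and spreading\<close>

text \<open>
  \<open>V j\<close> is $f_j'(0)$, taken one-sided because only the values of $f_j$ on $[0,1]$ matter.
\<close>

definition kpp_nonlinearity :: "nat \<Rightarrow> (int \<Rightarrow> real \<Rightarrow> real) \<Rightarrow> (int \<Rightarrow> real) \<Rightarrow> bool" where
  "kpp_nonlinearity N f V \<longleftrightarrow>
     periodic N f \<and>
     (\<forall>j. f j 0 = 0 \<and> f j 1 = 0 \<and>
          (f j has_real_derivative V j) (at 0 within {0..1}) \<and>
          (\<forall>s. 0 < s \<and> s < 1 \<longrightarrow> 0 < f j s \<and> f j s \<le> V j * s))"

text \<open>\<open>u t j\<close> is $u_j(t)$; \<open>T\<close> is the time domain. Solutions take values in $[0,1]$.\<close>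

definition lattice_solution ::
    "real set \<Rightarrow> real \<Rightarrow> (int \<Rightarrow> real \<Rightarrow> real) \<Rightarrow> (real \<Rightarrow> int \<Rightarrow> real) \<Rightarrow> bool" where
  "lattice_solution T d f u \<longleftrightarrow>
     (\<forall>t\<in>T. \<forall>j. 0 \<le> u t j \<and> u t j \<le> 1 \<and>
        ((\<lambda>s. u s j) has_real_derivative
           d * (u t (j + 1) + u t (j - 1) - 2 * u t j) + f j (u t j)) (at t within T))"

definition pulsating_front :: "real \<Rightarrow> nat \<Rightarrow> (int \<Rightarrow> real \<Rightarrow> real) \<Rightarrow> real \<Rightarrow> bool" where
  "pulsating_front d N f c \<longleftrightarrow>
     0 < c \<and>
     (\<exists>U :: real \<Rightarrow> int \<Rightarrow> real.
        (\<forall>\<xi>. periodic N (U \<xi>)) \<and>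
        (\<forall>j. ((\<lambda>\<xi>. U \<xi> j) \<longlongrightarrow> 1) at_bot \<and> ((\<lambda>\<xi>. U \<xi> j) \<longlongrightarrow> 0) at_top) \<and>
        lattice_solution UNIV d f (\<lambda>t j. U (real_of_int j - c * t) j))"

definition is_min_front_speed :: "real \<Rightarrow> nat \<Rightarrow> (int \<Rightarrow> real \<Rightarrow> real) \<Rightarrow> real \<Rightarrow> bool" where
  "is_min_front_speed d N f c \<longleftrightarrow>
     pulsating_front d N f c \<and> (\<forall>c'. pulsating_front d N f c' \<longrightarrow> c \<le> c')"

definition min_front_speed :: "real \<Rightarrow> nat \<Rightarrow> (int \<Rightarrow> real \<Rightarrow> real) \<Rightarrow> real" where
  "min_front_speed d N f = (THE c. is_min_front_speed d N f c)"

definition compact_datum :: "(int \<Rightarrow> real) \<Rightarrow> bool" where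
  "compact_datum u0 \<longleftrightarrow>
     (\<forall>j. 0 \<le> u0 j \<and> u0 j \<le> 1) \<and> finite {j. u0 j \<noteq> 0} \<and> {j. u0 j \<noteq> 0} \<noteq> {}"

definition decays_ahead :: "(real \<Rightarrow> int \<Rightarrow> real) \<Rightarrow> real \<Rightarrow> bool" where
  "decays_ahead u c \<longleftrightarrow>
     (\<forall>\<epsilon>>0. \<forall>\<^sub>F t in at_top. \<forall>j. real_of_int j \<ge> c * t \<longrightarrow> \<bar>u t j\<bar> < \<epsilon>)"

definition invades_behind :: "(real \<Rightarrow> int \<Rightarrow> real) \<Rightarrow> real \<Rightarrow> bool" where
  "invades_behind u c \<longleftrightarrow>
     (\<forall>\<epsilon>>0. \<forall>\<^sub>F t in at_top. \<forall>j. 0 \<le> j \<and> real_of_int j \<le> c * t \<longrightarrow> \<bar>u t j - 1\<bar> < \<epsilon>)"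

text \<open>
  Global existence for the Cauchy problem is part of the definition; without it the threshold
  property could hold vacuously and the threshold would not be unique.
\<close>

definition is_spreading_speed :: "real \<Rightarrow> (int \<Rightarrow> real \<Rightarrow> real) \<Rightarrow> real \<Rightarrow> bool" where
  "is_spreading_speed d f c \<longleftrightarrow>
     0 \<le> c \<and>
     (\<forall>u0. compact_datum u0 \<longrightarrow>
        (\<exists>u. lattice_solution {0..} d f u \<and> u 0 = u0) \<and>
        (\<forall>u. lattice_solution {0..} d f u \<and> u 0 = u0 \<longrightarrow>
           (\<forall>c'>c. decays_ahead u c') \<and> (\<forall>c'. 0 < c' \<and> c' < c \<longrightarrow> invades_behind u c')))"

definition spreading_speed :: "real \<Rightarrow> (int \<Rightarrow> real \<Rightarrow> real) \<Rightarrow> real" where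
  "spreading_speed d f = (THE c. is_spreading_speed d f c)"

text \<open>
  The conclusion of periodic lattice KPP theory for one nonlinearity \<open>f\<close> with linear growth
  rates \<open>V\<close>: both speeds exist and equal $\inf_{p>0}\Lambda_p(V)/p$. The theory is not developed
  here; statements about the dynamical speeds take this as a hypothesis on the nonlinearities
  that occur, in place of any particular set of regularity assumptions on \<open>f\<close> implying it.
\<close>

definition kpp_speeds_eq_cstar ::
    "real \<Rightarrow> nat \<Rightarrow> (int \<Rightarrow> real \<Rightarrow> real) \<Rightarrow> (int \<Rightarrow> real) \<Rightarrow> bool" where
  "kpp_speeds_eq_cstar d N f V \<longleftrightarrow>
     is_min_front_speed d N f (cstar d N V) \<and> is_spreading_speed d f (cstar d N V)"

end

theory Submission
  imports Defs
begin

text \<open>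
  Let \<open>u\<close> and \<open>v\<close> be the right and left principal eigenvectors and write \<open>u = a e\<^sup>h\<close>. Minimising over
  \<open>h\<close> gives a variational formula in which \<open>\<Lambda>\<^sub>p(V)\<close> is the maximum, over positive \<open>a\<close> of norm one and
  over real \<open>\<kappa>\<close>, of \<open>\<Sum> V\<^sub>j a\<^sub>j\<^sup>2 - 2d + 2d (\<Sum> g\<^sub>\<kappa>(a\<^sub>j a\<^sub>j\<^sub>+\<^sub>1) - \<kappa>Np)\<close> with
  \<open>g\<^sub>\<kappa>(w) = min\<^sub>\<theta> (w cosh \<theta> - \<kappa>\<theta>)\<close>; the optimal \<open>a\<close> is \<open>\<surd>(uv)\<close>. Since \<open>g\<^sub>\<kappa>(e\<^sup>s)\<close> is convex in \<open>s\<close>, polarizing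
  \<open>V\<close> and \<open>a\<close> with respect to a reflection of the cycle can only increase this expression, hence
  \<open>\<Lambda>\<^sub>p\<close> for every \<open>p\<close>, and finitely many polarizations turn any \<open>V\<close> into its bell order.
\<close>

section \<open>Sums over a period\<close>

lemma periodic_cong_mod:
  assumes "periodic N x" "a mod int N = b mod int N"
  shows "x a = x b"
  using periodic_mod[OF assms(1)] assms(2) by metis

lemma periodicI_shift: "periodic N x \<Longrightarrow> periodic N (\<lambda>j. x (j + k))"
  unfolding periodic_def by (metis add.assoc add.commute)

lemma periodicI_reflect:
  assumes "periodic N x"
  shows "periodic N (\<lambda>j. x (s - j))"
  unfolding periodic_def
proof
  fix j
  show "x (s - (j + int N)) = x (s - j)"
    using assms unfolding periodic_def by (metis add_diff_cancel_right' diff_diff_eq2 diff_add_cancel diff_diff_eq)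
qed

lemma sum_period_shift:
  fixes G :: "int \<Rightarrow> 'a::comm_monoid_add"
  assumes "N > 0" "periodic N G"
  shows "(\<Sum>x\<in>{0..<int N}. G (x + k)) = sum G {0..<int N}"
proof (rule sum.reindex_bij_witness[where i = "\<lambda>y. (y - k) mod int N" and j = "\<lambda>x. (x + k) mod int N"])
  fix x assume "x \<in> {0..<int N}"
  then show "((x + k) mod int N - k) mod int N = x" "(x + k) mod int N \<in> {0..<int N}"
    "((x - k) mod int N + k) mod int N = x" "(x - k) mod int N \<in> {0..<int N}"
    using assms(1) by (simp_all add: mod_simps)
  show "G ((x + k) mod int N) = G (x + k)"
    by (rule periodic_mod[OF assms(2)])
qed

lemma sum_period_reflect:
  fixes G :: "int \<Rightarrow> 'a::comm_monoid_add"
  assumes "N > 0" "periodic N G"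
  shows "(\<Sum>x\<in>{0..<int N}. G (s - x)) = sum G {0..<int N}"
proof (rule sum.reindex_bij_witness[where i = "\<lambda>y. (s - y) mod int N" and j = "\<lambda>x. (s - x) mod int N"])
  fix x assume "x \<in> {0..<int N}"
  then show "(s - (s - x) mod int N) mod int N = x" "(s - x) mod int N \<in> {0..<int N}"
    "(s - (s - x) mod int N) mod int N = x" "(s - x) mod int N \<in> {0..<int N}"
    using assms(1) by (simp_all add: mod_simps)
  show "G ((s - x) mod int N) = G (s - x)"
    by (rule periodic_mod[OF assms(2)])
qed

section \<open>Existence of the principal eigenvalue\<close>

text \<open>
  Perron--Frobenius by compactness: a pair with maximal \<open>\<lambda>\<close> among the \<open>\<phi>\<close> in the simplex with
  \<open>\<lambda> \<phi> \<le> M \<phi>\<close> is an eigenpair, since otherwise \<open>M ^^ N\<close> would make the inequality strict everywhere.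
\<close>

lemma compact_periodic_simplex:
  "compact {\<phi> :: int \<Rightarrow> real. periodic N \<phi> \<and> (\<forall>j. 0 \<le> \<phi> j) \<and> sum \<phi> {0..<int N} = 1}"
  (is "compact ?K")
proof -
  \<comment> \<open>Tychonoff: in the product topology the box is compact although the index set is
    infinite, and each constraint of the simplex is closed.\<close>
  have box: "compact (PiE UNIV (\<lambda>_::int. {0..1::real}))"
    using compactin_PiE[of "\<lambda>_. euclidean :: real topology" "UNIV :: int set" "\<lambda>_. {0..1}"]
    by (simp add: euclidean_product_topology)
  have coord: "continuous_on UNIV (\<lambda>\<phi> :: int \<Rightarrow> real. \<phi> j)" for j
    by (rule continuous_on_product_coordinates)
  have "closed {\<phi> :: int \<Rightarrow> real. \<forall>j. \<phi> (j + int N) = \<phi> j}"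
    by (intro closed_Collect_all closed_Collect_eq coord)
  moreover have "closed {\<phi> :: int \<Rightarrow> real. \<forall>j. 0 \<le> \<phi> j}"
    by (intro closed_Collect_all closed_Collect_le coord continuous_on_const)
  moreover have "closed {\<phi> :: int \<Rightarrow> real. sum \<phi> {0..<int N} = 1}"
    by (intro closed_Collect_eq continuous_on_sum coord continuous_on_const)
  ultimately have "closed ?K"
    unfolding periodic_def by (intro closed_Collect_conj) auto
  moreover have "?K \<subseteq> PiE UNIV (\<lambda>_. {0..1})"
  proof
    fix \<phi> assume "\<phi> \<in> ?K"
    then have \<phi>: "periodic N \<phi>" "\<And>j. 0 \<le> \<phi> j" "sum \<phi> {0..<int N} = 1" by auto
    have "N > 0" using \<phi>(3) by (cases N) auto
    have "\<phi> j \<le> 1" for j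
    proof -
      have "\<phi> (j mod int N) \<le> sum \<phi> {0..<int N}"
        using \<open>N > 0\<close> \<phi>(2) by (intro member_le_sum) auto
      then show ?thesis using \<phi>(3) periodic_mod[OF \<phi>(1)] by simp
    qed
    then show "\<phi> \<in> PiE UNIV (\<lambda>_. {0..1})" using \<phi>(2) by auto
  qed
  ultimately show ?thesis
    using compact_Int_closed[OF box, of ?K] by (simp add: Int_absorb1)
qed

lemma positive_eigenvector_exists:
  fixes \<alpha> \<beta> :: real and b :: "int \<Rightarrow> real"
  assumes N: "N > 0" and \<alpha>: "\<alpha> > 0" and \<beta>: "\<beta> > 0" and b: "\<And>j. b j > 0" "periodic N b"
  shows "\<exists>l \<phi>. periodic N \<phi> \<and> (\<forall>j. \<phi> j > 0) \<and>
           (\<forall>j. \<alpha> * \<phi> (j + 1) + \<beta> * \<phi> (j - 1) + b j * \<phi> j = l * \<phi> j)"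
proof -
  define M where "M \<phi> = (\<lambda>j. \<alpha> * \<phi> (j + 1) + \<beta> * \<phi> (j - 1) + b j * \<phi> j)" for \<phi> :: "int \<Rightarrow> real"
  let ?I = "{0..<int N}"
  have M_per: "periodic N (M \<phi>)" if "periodic N \<phi>" for \<phi>
  proof -
    have "\<phi> (j + int N + 1) = \<phi> (j + 1)" "\<phi> (j + int N - 1) = \<phi> (j - 1)" for j
      using that unfolding periodic_def by (metis add.assoc add.commute, metis add_diff_eq diff_add_eq)
    then show ?thesis using b(2) that unfolding periodic_def M_def by simp
  qed
  have Mk_per: "periodic N ((M ^^ k) \<phi>)" if "periodic N \<phi>" for \<phi> k
    using that by (induction k) (auto intro: M_per)
  have Mk_nonneg: "(M ^^ k) \<phi> j \<ge> 0" if "\<And>j. \<phi> j \<ge> 0" for \<phi> k j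
  proof (induction k arbitrary: j)
    case (Suc k)
    then show ?case using \<alpha> \<beta> b(1) by (simp add: M_def less_imp_le)
  qed (simp add: that)
  have Mk_pos: "(M ^^ N) \<phi> j > 0" if per: "periodic N \<phi>" and nn: "\<And>j. \<phi> j \<ge> 0" and i: "\<phi> i > 0" for \<phi> i j
  proof -
    \<comment> \<open>Each application of \<open>M\<close> carries positivity one site to the left
      through \<open>\<alpha>\<close>, while the diagonal \<open>b\<close> keeps what is already
      positive.\<close>
    have spread: "(M ^^ k) \<phi> (i - int m) > 0" if "m \<le> k" for k m
      using that
    proof (induction k arbitrary: m)
      case (Suc k)
      let ?\<psi> = "(M ^^ k) \<phi>"
      have nn': "?\<psi> j \<ge> 0" for j by (rule Mk_nonneg[OF nn])
      have M_eq: "(M ^^ Suc k) \<phi> x = \<alpha> * ?\<psi> (x + 1) + \<beta> * ?\<psi> (x - 1) + b x * ?\<psi> x" for x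
        by (simp add: M_def)
      show ?case
      proof (cases "m \<le> k")
        case True
        then have "b (i - int m) * ?\<psi> (i - int m) > 0" using Suc.IH b(1) by simp
        moreover have "\<alpha> * ?\<psi> (i - int m + 1) \<ge> 0" "\<beta> * ?\<psi> (i - int m - 1) \<ge> 0"
          using \<alpha> \<beta> nn' by auto
        ultimately show ?thesis unfolding M_eq by linarith
      next
        case False
        then have "m = Suc k" using Suc.prems by simp
        then have "\<alpha> * ?\<psi> (i - int m + 1) > 0" using Suc.IH[of k] \<alpha> by simp
        moreover have "b (i - int m) * ?\<psi> (i - int m) \<ge> 0" "\<beta> * ?\<psi> (i - int m - 1) \<ge> 0"
          using b(1) \<beta> nn' by (auto simp: less_imp_le)
        ultimately show ?thesis unfolding M_eq by linarith
      qed
    qed (simp add: i)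
    \<comment> \<open>The number of steps to the left from \<open>i\<close> to \<open>j\<close> on
      the cycle, less than \<open>N\<close>.\<close>
    define m where "m = nat ((i - j) mod int N)"
    have "(i - int m) mod int N = j mod int N" using N by (simp add: m_def mod_simps)
    then have "(M ^^ N) \<phi> (i - int m) = (M ^^ N) \<phi> j"
      by (rule periodic_cong_mod[OF Mk_per[OF per]])
    moreover have "m \<le> N" using N by (simp add: m_def nat_le_iff less_imp_le)
    ultimately show ?thesis using spread[of m N] by simp
  qed
  have M_diff: "M (\<lambda>j. f j - l * h j) = (\<lambda>j. M f j - l * M h j)" for f h l
    by (simp add: M_def fun_eq_iff algebra_simps)
  have M_lin: "(M ^^ k) (\<lambda>j. M \<phi> j - l * \<phi> j) = (\<lambda>j. M ((M ^^ k) \<phi>) j - l * (M ^^ k) \<phi> j)" for k \<phi> l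
    by (induction k) (simp_all add: M_diff)
  \<comment> \<open>Summing \<open>l * \<phi> j \<le> M \<phi> j\<close> over a period bounds
    \<open>l\<close> by \<open>R\<close>, since each \<open>\<phi> j\<close> is at most 1; this
    confines \<open>C\<close> to a compact set.\<close>
  define R where "R = \<alpha> + \<beta> + sum b ?I"
  define K where "K = {\<phi> :: int \<Rightarrow> real. periodic N \<phi> \<and> (\<forall>j. 0 \<le> \<phi> j) \<and> sum \<phi> ?I = 1}"
  define C where "C = {(l, \<phi>). l \<in> {0..R} \<and> \<phi> \<in> K \<and> (\<forall>j. l * \<phi> j \<le> M \<phi> j)}"
  have le_R: "l \<le> R" if \<phi>: "\<phi> \<in> K" and l: "\<And>j. l * \<phi> j \<le> M \<phi> j" for l \<phi>
  proof -
    have per: "periodic N \<phi>" and nn: "\<And>j. \<phi> j \<ge> 0" and one: "sum \<phi> ?I = 1" using \<phi> by (auto simp: K_def)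
    have "l = (\<Sum>j\<in>?I. l * \<phi> j)" using one by (simp add: sum_distrib_left[symmetric])
    also have "\<dots> \<le> sum (M \<phi>) ?I" by (intro sum_mono l)
    also have "\<dots> = \<alpha> * (\<Sum>j\<in>?I. \<phi> (j + 1)) + \<beta> * (\<Sum>j\<in>?I. \<phi> (j + (-1))) + (\<Sum>j\<in>?I. b j * \<phi> j)"
      by (simp add: M_def sum.distrib sum_distrib_left)
    also have "\<dots> = \<alpha> + \<beta> + (\<Sum>j\<in>?I. b j * \<phi> j)"
      unfolding sum_period_shift[OF N per] one by simp
    also have "(\<Sum>j\<in>?I. b j * \<phi> j) \<le> (\<Sum>j\<in>?I. b j * 1)"
    proof (intro sum_mono mult_left_mono)
      fix j assume "j \<in> ?I"
      then show "\<phi> j \<le> 1" unfolding one[symmetric] using nn by (intro member_le_sum) auto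
    qed (use b(1) less_imp_le in auto)
    finally show ?thesis by (simp add: R_def)
  qed
  have "compact C"
  proof -
    have coord: "continuous_on UNIV (\<lambda>z :: real \<times> (int \<Rightarrow> real). snd z j)" for j
      by (rule continuous_on_compose2[OF continuous_on_product_coordinates])
        (auto intro: continuous_intros)
    have "closed {z :: real \<times> (int \<Rightarrow> real). \<forall>j. fst z * snd z j \<le> M (snd z) j}"
      unfolding M_def
      by (intro closed_Collect_all closed_Collect_le continuous_on_add continuous_on_mult
          continuous_on_const coord continuous_on_fst continuous_on_id)
    moreover have "compact ({0..R} \<times> K)"
      unfolding K_def by (intro compact_Times compact_Icc compact_periodic_simplex)
    moreover have "C = ({0..R} \<times> K) \<inter> {z. \<forall>j. fst z * snd z j \<le> M (snd z) j}"
      by (auto simp: C_def)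
    ultimately show ?thesis by (simp add: compact_Int_closed)
  qed
  moreover have "C \<noteq> {}"
  proof -
    have "(\<lambda>_. 1 / real N) \<in> K" using N by (simp add: K_def periodic_def)
    moreover have "\<forall>j. 0 * (1 / real N) \<le> M (\<lambda>_. 1 / real N) j"
      using \<alpha> \<beta> b(1) by (simp add: M_def less_imp_le)
    moreover have "0 \<le> R" using \<alpha> \<beta> b(1) by (simp add: R_def sum_nonneg less_imp_le)
    ultimately have "(0, \<lambda>_. 1 / real N) \<in> C" by (simp add: C_def)
    then show ?thesis by blast
  qed
  moreover have "continuous_on C fst" by (intro continuous_intros)
  ultimately obtain z where z: "z \<in> C" "\<And>y. y \<in> C \<Longrightarrow> fst y \<le> fst z"
    using continuous_attains_sup[of C fst] by blast
  obtain l \<phi> where z_eq: "z = (l, \<phi>)" by force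
  have l0: "0 \<le> l" and per: "periodic N \<phi>" and nn: "\<And>j. \<phi> j \<ge> 0" and one: "sum \<phi> ?I = 1"
    and sub: "\<And>j. l * \<phi> j \<le> M \<phi> j"
    using z(1) by (auto simp: z_eq C_def K_def)
  obtain i where i: "\<phi> i > 0"
  proof -
    have "\<exists>i. \<phi> i \<noteq> 0" using one by (metis sum.neutral zero_neq_one)
    then show thesis using that nn by (metis order_le_less)
  qed
  define \<psi> where "\<psi> = (M ^^ N) \<phi>"
  have \<psi>_pos: "\<psi> j > 0" for j unfolding \<psi>_def by (rule Mk_pos[OF per nn i])
  have \<psi>_per: "periodic N \<psi>" unfolding \<psi>_def by (rule Mk_per[OF per])
  have eq: "M \<phi> j = l * \<phi> j" for j
  proof (rule ccontr)
    assume "M \<phi> j \<noteq> l * \<phi> j"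
    define g where "g = (\<lambda>j. M \<phi> j - l * \<phi> j)"
    have "periodic N g" using M_per[OF per] per by (simp add: g_def periodic_def)
    moreover have "g j \<ge> 0" for j using sub by (simp add: g_def)
    moreover have "g j > 0" using sub[of j] \<open>M \<phi> j \<noteq> l * \<phi> j\<close> by (simp add: g_def)
    ultimately have "(M ^^ N) g i > 0" for i by (rule Mk_pos)
    \<comment> \<open>By \<open>M_lin\<close>, the defect of \<open>\<psi>\<close> is
      \<open>M ^^ N\<close> applied to the defect \<open>g\<close> of \<open>\<phi>\<close>.\<close>
    then have strict: "M \<psi> i - l * \<psi> i > 0" for i unfolding g_def M_lin \<psi>_def .
    \<comment> \<open>The minimum \<open>e\<close> of the relative slack \<open>q\<close> is
      positive, so \<open>l\<close> can be raised to \<open>l + e\<close> for \<open>\<psi>\<close>;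
      normalising \<open>\<psi>\<close> contradicts the maximality of \<open>l\<close>.\<close>
    define q where "q = (\<lambda>j. (M \<psi> j - l * \<psi> j) / \<psi> j)"
    define e where "e = Min (q ` ?I)"
    have fin: "finite (q ` ?I)" "q ` ?I \<noteq> {}" using N by auto
    have "e \<in> q ` ?I" unfolding e_def by (rule Min_in[OF fin])
    then have "e > 0" using strict \<psi>_pos by (auto simp: q_def)
    have "periodic N q" using M_per[OF \<psi>_per] \<psi>_per by (simp add: q_def periodic_def)
    have e_le: "e \<le> q j" for j
    proof -
      have "e \<le> q (j mod int N)" unfolding e_def using N by (intro Min_le fin) auto
      then show ?thesis by (simp add: periodic_mod[OF \<open>periodic N q\<close>])
    qed
    have sup: "(l + e) * \<psi> j \<le> M \<psi> j" for j
    proof -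
      have "e \<le> (M \<psi> j - l * \<psi> j) / \<psi> j" using e_le[of j] unfolding q_def .
      then have "e * \<psi> j \<le> M \<psi> j - l * \<psi> j" unfolding pos_le_divide_eq[OF \<psi>_pos] .
      then show ?thesis unfolding distrib_right by linarith
    qed
    define S where "S = sum \<psi> ?I"
    have "S > 0" unfolding S_def using N \<psi>_pos by (intro sum_pos) auto
    define \<eta> where "\<eta> = (\<lambda>j. \<psi> j / S)"
    have "sum \<eta> ?I = S / S" unfolding \<eta>_def S_def by (rule sum_divide_distrib[symmetric])
    moreover have "\<eta> j \<ge> 0" for j using \<psi>_pos[of j] \<open>S > 0\<close> by (simp add: \<eta>_def)
    moreover have "periodic N \<eta>" using \<psi>_per by (simp add: \<eta>_def periodic_def)
    ultimately have "\<eta> \<in> K" using \<open>S > 0\<close> by (simp add: K_def)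
    moreover have \<eta>_sub: "(l + e) * \<eta> j \<le> M \<eta> j" for j
    proof -
      have "M \<eta> j = M \<psi> j / S" by (simp add: M_def \<eta>_def add_divide_distrib)
      then show ?thesis using divide_right_mono[OF sup[of j], of S] \<open>S > 0\<close> by (simp add: \<eta>_def)
    qed
    ultimately have "(l + e, \<eta>) \<in> C" using le_R l0 \<open>e > 0\<close> by (simp add: C_def)
    then have "l + e \<le> l" using z(2)[of "(l + e, \<eta>)"] by (simp add: z_eq)
    then show False using \<open>e > 0\<close> by simp
  qed
  \<comment> \<open>A zero of \<open>\<phi>\<close> would be a zero of
    \<open>(M ^^ N) \<phi> = \<psi>\<close>, which is positive everywhere.\<close>
  have "(M ^^ k) \<phi> j = l ^ k * \<phi> j" for k j
  proof (induction k arbitrary: j)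
    case (Suc k)
    have "(M ^^ k) \<phi> = (\<lambda>j. l ^ k * \<phi> j)" using Suc by blast
    then have "(M ^^ Suc k) \<phi> j = l ^ k * M \<phi> j"
      by (simp add: M_def algebra_simps)
    then show ?case by (simp add: eq)
  qed simp
  then have "l ^ N * \<phi> j > 0" for j using \<psi>_pos[of j] by (simp add: \<psi>_def)
  then have "\<phi> j \<noteq> 0" for j by (metis less_irrefl mult_zero_right)
  then have "\<phi> j > 0" for j using nn[of j] by (metis order_le_less)
  moreover have "\<alpha> * \<phi> (j + 1) + \<beta> * \<phi> (j - 1) + b j * \<phi> j = l * \<phi> j" for j
    using eq[of j] by (simp add: M_def)
  ultimately show ?thesis using per by blast
qed

lemma is_principal_eigenvalue_exists:
  assumes N: "N > 0" and d: "d > 0" and V: "periodic N V"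
  shows "\<exists>\<Lambda>. is_principal_eigenvalue d N p V \<Lambda>"
proof -
  \<comment> \<open>This shift makes every diagonal entry at least 1; it is subtracted from the
    eigenvalue at the end, together with \<open>2 * d\<close>.\<close>
  define c where "c = 1 - Min (V ` {0..<int N})"
  have b_pos: "V j + c > 0" for j
  proof -
    have "Min (V ` {0..<int N}) \<le> V (j mod int N)" using N by (intro Min_le) auto
    then show ?thesis by (simp add: c_def periodic_mod[OF V])
  qed
  have "periodic N (\<lambda>j. V j + c)" using V by (simp add: periodic_def)
  then obtain l \<phi> where \<phi>: "periodic N \<phi>" "\<And>j. \<phi> j > 0"
    "\<And>j. d * exp (- p) * \<phi> (j + 1) + d * exp p * \<phi> (j - 1) + (V j + c) * \<phi> j = l * \<phi> j"
    using positive_eigenvector_exists[of N "d * exp (- p)" "d * exp p" "\<lambda>j. V j + c"] N d b_pos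
    by (metis exp_gt_zero mult_pos_pos)
  have "tilted_op d p V \<phi> j = (l - c - 2 * d) * \<phi> j" for j
    using \<phi>(3)[of j] by (simp add: tilted_op_def algebra_simps)
  then have "is_principal_eigenvalue d N p V (l - c - 2 * d)"
    using \<phi>(1,2) unfolding is_principal_eigenvalue_def by (intro exI[of _ \<phi>]) simp
  then show ?thesis ..
qed

lemma is_principal_eigenvalue_principal_eigenvalue:
  assumes "N > 0" "d > 0" "periodic N V"
  shows "is_principal_eigenvalue d N p V (principal_eigenvalue d N p V)"
  unfolding principal_eigenvalue_def
proof (rule theI')
  have "N > 0" "d \<ge> 0" using assms by auto
  then show "\<exists>!\<Lambda>. is_principal_eigenvalue d N p V \<Lambda>"
    using is_principal_eigenvalue_exists[OF assms, of p] is_principal_eigenvalue_unique[of N d p V]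
    by blast
qed

lemma principal_eigenvalue_eqI:
  assumes "N > 0" "d > 0" "is_principal_eigenvalue d N p V \<Lambda>"
  shows "principal_eigenvalue d N p V = \<Lambda>"
  unfolding principal_eigenvalue_def
proof (rule the_equality)
  show "\<Lambda>' = \<Lambda>" if "is_principal_eigenvalue d N p V \<Lambda>'" for \<Lambda>'
    using is_principal_eigenvalue_unique[OF assms(1) _ that assms(3)] assms(2) by simp
qed (rule assms(3))

section \<open>A variational formula for the principal eigenvalue\<close>

text \<open>
  \<open>legendre \<kappa> w\<close> is the minimum of \<open>w * cosh \<theta> - \<kappa> * \<theta>\<close> over \<open>\<theta>\<close>, written at its minimiser. As a
  partial minimum of a jointly convex function of \<open>(ln w, \<theta>)\<close> it is convex in \<open>ln w\<close>, so
  \<open>legendre \<kappa> (a * b)\<close> is supermodular in \<open>(a, b)\<close>.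
\<close>

definition legendre :: "real \<Rightarrow> real \<Rightarrow> real" where
  "legendre \<kappa> w = w * cosh (arsinh (\<kappa> / w)) - \<kappa> * arsinh (\<kappa> / w)"

lemma legendre_eq:
  assumes "w > 0" "w * sinh \<theta> = \<kappa>"
  shows "legendre \<kappa> w = w * cosh \<theta> - \<kappa> * \<theta>"
proof -
  have "\<kappa> / w = sinh \<theta>" using assms by (simp add: field_simps)
  then show ?thesis by (simp add: legendre_def arsinh_sinh_real)
qed

lemma cosh_ge_tangent: "cosh \<theta>\<^sub>0 + sinh \<theta>\<^sub>0 * (\<theta> - \<theta>\<^sub>0) \<le> cosh (\<theta> :: real)"
proof -
  have e: "exp x * (1 + (y - x)) \<le> exp y" for x y :: real
    using exp_ge_add_one_self[of "y - x"] by (simp add: exp_diff field_simps)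
  show ?thesis using e[of \<theta>\<^sub>0 \<theta>] e[of "- \<theta>\<^sub>0" "- \<theta>"]
    by (simp add: cosh_field_def sinh_field_def field_simps)
qed

text \<open>At \<open>\<theta>\<^sub>0\<close> the slope \<open>w * sinh \<theta>\<^sub>0\<close> of
  the tangent equals \<kappa>, so the tangent inequality of \<open>cosh\<close> says exactly that
  \<open>\<theta>\<^sub>0\<close> is a minimiser.\<close>

lemma legendre_le:
  assumes "w > 0"
  shows "legendre \<kappa> w \<le> w * cosh \<theta> - \<kappa> * \<theta>"
proof -
  define \<theta>\<^sub>0 where "\<theta>\<^sub>0 = arsinh (\<kappa> / w)"
  have s: "w * sinh \<theta>\<^sub>0 = \<kappa>" using assms by (simp add: \<theta>\<^sub>0_def)
  have "w * (cosh \<theta>\<^sub>0 + sinh \<theta>\<^sub>0 * (\<theta> - \<theta>\<^sub>0)) \<le> w * cosh \<theta>"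
    using assms by (intro mult_left_mono cosh_ge_tangent) simp
  moreover have "w * (cosh \<theta>\<^sub>0 + sinh \<theta>\<^sub>0 * (\<theta> - \<theta>\<^sub>0)) = w * cosh \<theta>\<^sub>0 + \<kappa> * (\<theta> - \<theta>\<^sub>0)"
    by (simp add: s[symmetric] algebra_simps)
  ultimately show ?thesis using legendre_eq[OF assms s] by (simp add: algebra_simps)
qed

lemma legendre_supermodular:
  assumes "0 < a" "a \<le> a'" "0 < b" "b \<le> b'"
  shows "legendre \<kappa> (a * b') + legendre \<kappa> (a' * b) \<le> legendre \<kappa> (a * b) + legendre \<kappa> (a' * b')"
proof (cases "a = a' \<or> b = b'")
  case True
  then show ?thesis by auto
next
  case False
  then have lt: "a < a'" "b < b'" using assms by auto
  \<comment> \<open>On the logarithmic scale \<open>a * b'\<close> and \<open>a' * b\<close> divide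
    the segment from \<open>a * b\<close> to \<open>a' * b'\<close> in the ratios \<open>t\<close>
    and \<open>1 - t\<close>.\<close>
  define A where "A = ln a' - ln a"
  define B where "B = ln b' - ln b"
  have AB: "A > 0" "B > 0" using lt assms by (simp_all add: A_def B_def)
  define t where "t = B / (A + B)"
  have t: "0 \<le> t" "t \<le> 1" "t * (A + B) = B" using AB by (simp_all add: t_def)
  define \<theta>\<^sub>0 where "\<theta>\<^sub>0 = arsinh (\<kappa> / (a * b))"
  define \<theta>\<^sub>3 where "\<theta>\<^sub>3 = arsinh (\<kappa> / (a' * b'))"
  \<comment> \<open>Trial exponents for the mixed products: the same convex combinations of the
    minimisers at the two ends. Their sum is \<open>\<theta>\<^sub>0 + \<theta>\<^sub>3\<close>, so
    the linear terms balance.\<close>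
  define \<theta>\<^sub>1 where "\<theta>\<^sub>1 = (1 - t) * \<theta>\<^sub>0 + t * \<theta>\<^sub>3"
  define \<theta>\<^sub>2 where "\<theta>\<^sub>2 = t * \<theta>\<^sub>0 + (1 - t) * \<theta>\<^sub>3"
  \<comment> \<open>Joint convexity becomes visible: the exponents are affine in the logarithm of
    the product and in \<theta>.\<close>
  have wc: "x * y * cosh \<theta> = (exp (ln x + ln y + \<theta>) + exp (ln x + ln y - \<theta>)) / 2"
    if "x > 0" "y > 0" for x y \<theta> :: real
    using that by (simp add: cosh_field_def exp_add exp_diff exp_minus field_simps)
  have cvx: "exp ((1 - s) * x + s * y) \<le> (1 - s) * exp x + s * exp y" if "0 \<le> s" "s \<le> 1" for s x y :: real
    using convex_onD[OF exp_convex, of s x y] that by simp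
  have two: "exp ((1 - t) * x + t * y) + exp (t * x + (1 - t) * y) \<le> exp x + exp y" for x y
    using cvx[OF t(1,2), of x y] cvx[of "1 - t" x y] t(1,2) by (simp add: algebra_simps)
  have s1: "ln a + ln b' = (1 - t) * (ln a + ln b) + t * (ln a' + ln b')"
    and s2: "ln a' + ln b = t * (ln a + ln b) + (1 - t) * (ln a' + ln b')"
    using t(3) by (simp_all add: A_def B_def algebra_simps)
  let ?s0 = "ln a + ln b" and ?s3 = "ln a' + ln b'"
  have exps: "ln a + ln b' + \<theta>\<^sub>1 = (1 - t) * (?s0 + \<theta>\<^sub>0) + t * (?s3 + \<theta>\<^sub>3)"
    "ln a + ln b' - \<theta>\<^sub>1 = (1 - t) * (?s0 - \<theta>\<^sub>0) + t * (?s3 - \<theta>\<^sub>3)"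
    "ln a' + ln b + \<theta>\<^sub>2 = t * (?s0 + \<theta>\<^sub>0) + (1 - t) * (?s3 + \<theta>\<^sub>3)"
    "ln a' + ln b - \<theta>\<^sub>2 = t * (?s0 - \<theta>\<^sub>0) + (1 - t) * (?s3 - \<theta>\<^sub>3)"
    unfolding s1 s2 \<theta>\<^sub>1_def \<theta>\<^sub>2_def by algebra+
  have pos: "a > 0" "b > 0" "a' > 0" "b' > 0" using assms by auto
  have "a * b' * cosh \<theta>\<^sub>1 + a' * b * cosh \<theta>\<^sub>2 \<le> a * b * cosh \<theta>\<^sub>0 + a' * b' * cosh \<theta>\<^sub>3"
    unfolding wc[OF pos(1,2)] wc[OF pos(1,4)] wc[OF pos(3,2)] wc[OF pos(3,4)] exps
    using two[of "?s0 + \<theta>\<^sub>0" "?s3 + \<theta>\<^sub>3"] two[of "?s0 - \<theta>\<^sub>0" "?s3 - \<theta>\<^sub>3"] by argo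
  moreover have "legendre \<kappa> (a * b') \<le> a * b' * cosh \<theta>\<^sub>1 - \<kappa> * \<theta>\<^sub>1"
    "legendre \<kappa> (a' * b) \<le> a' * b * cosh \<theta>\<^sub>2 - \<kappa> * \<theta>\<^sub>2"
    using assms by (auto intro!: legendre_le)
  moreover have "\<theta>\<^sub>1 + \<theta>\<^sub>2 = \<theta>\<^sub>0 + \<theta>\<^sub>3" by (simp add: \<theta>\<^sub>1_def \<theta>\<^sub>2_def algebra_simps)
  then have "\<kappa> * \<theta>\<^sub>1 + \<kappa> * \<theta>\<^sub>2 = \<kappa> * \<theta>\<^sub>0 + \<kappa> * \<theta>\<^sub>3" by (metis distrib_left)
  ultimately show ?thesis
    unfolding legendre_def[of \<kappa> "a * b"] legendre_def[of \<kappa> "a' * b'"] \<theta>\<^sub>0_def[symmetric] \<theta>\<^sub>3_def[symmetric]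
    by linarith
qed

text \<open>\<kappa> is the Lagrange multiplier of the constraint that the exponents on the bonds
  sum to \<open>- (real N * p)\<close>. Instead of normalising \<open>a\<close>, the bounds carry
  the factor given by the sum of its squares.\<close>

definition energy :: "real \<Rightarrow> nat \<Rightarrow> real \<Rightarrow> (int \<Rightarrow> real) \<Rightarrow> real \<Rightarrow> (int \<Rightarrow> real) \<Rightarrow> real" where
  "energy d N p V \<kappa> a =
     (\<Sum>j\<in>{0..<int N}. V j * (a j)\<^sup>2) - 2 * d * (\<Sum>j\<in>{0..<int N}. (a j)\<^sup>2)
     + 2 * d * ((\<Sum>j\<in>{0..<int N}. legendre \<kappa> (a j * a (j + 1))) - \<kappa> * (real N * p))"

lemma exp_ln_diff:
  fixes x y p :: real
  assumes "x > 0" "y > 0"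
  shows "exp (ln x - ln y - p) = exp (- p) * x / y"
    and "exp (- (ln x - ln y - p)) = exp p * y / x"
  using assms by (simp_all add: exp_add exp_diff exp_minus field_simps)

text \<open>The exponents \<open>\<theta>\<close> come from the substitution \<open>u j = a j * exp (h j)\<close>.\<close>

lemma rayleigh_identity:
  fixes u a :: "int \<Rightarrow> real"
  assumes N: "N > 0"
    and u: "periodic N u" "\<And>j. u j > 0" "\<And>j. tilted_op d p V u j = \<Lambda> * u j"
    and a: "periodic N a" "\<And>j. a j > 0"
    and \<theta>: "\<theta> = (\<lambda>j. ln (u (j + 1) / a (j + 1)) - ln (u j / a j) - p)"
  shows "\<Lambda> * (\<Sum>j\<in>{0..<int N}. (a j)\<^sup>2) =
           (\<Sum>j\<in>{0..<int N}. V j * (a j)\<^sup>2) - 2 * d * (\<Sum>j\<in>{0..<int N}. (a j)\<^sup>2)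
           + 2 * d * (\<Sum>j\<in>{0..<int N}. a j * a (j + 1) * cosh (\<theta> j))" (is ?eq)
    and "(\<Sum>j\<in>{0..<int N}. \<theta> j) = - (real N * p)"
proof -
  let ?I = "{0..<int N}"
  \<comment> \<open>\<open>P j\<close> and \<open>Q j\<close> both belong to the bond between
    \<open>j\<close> and \<open>j + 1\<close>. The equation at site \<open>j\<close> contains
    \<open>P j\<close> and the \<open>Q\<close> of the preceding bond; shifting one sum pairs
    them.\<close>
  define P where "P = (\<lambda>j. (a j)\<^sup>2 * exp (- p) * u (j + 1) / u j)"
  define Q where "Q = (\<lambda>j. (a (j + 1))\<^sup>2 * exp p * u j / u (j + 1))"
  have [simp]: "u j \<noteq> 0" "a j \<noteq> 0" for j using u(2)[of j] a(2)[of j] by auto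
  have perQ: "periodic N Q"
    using periodicI_shift[OF u(1), of 1] periodicI_shift[OF a(1), of 1] u(1)
    by (simp add: periodic_def Q_def)
  have pointwise: "\<Lambda> * (a j)\<^sup>2 = V j * (a j)\<^sup>2 - 2 * d * (a j)\<^sup>2 + d * (P j + Q (j + (-1)))" for j
  proof -
    have "\<Lambda> * (a j)\<^sup>2 = (a j)\<^sup>2 / u j * (\<Lambda> * u j)" by simp
    also have "\<dots> = (a j)\<^sup>2 / u j * tilted_op d p V u j" by (simp only: u(3))
    also have "\<dots> = V j * (a j)\<^sup>2 - 2 * d * (a j)\<^sup>2 + d * (P j + Q (j + (-1)))"
      by (simp add: tilted_op_def P_def Q_def field_simps)
    finally show ?thesis .
  qed
  have exp_th: "exp (\<theta> j) = exp (- p) * (u (j + 1) * a j) / (a (j + 1) * u j)"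
    "exp (- \<theta> j) = exp p * (a (j + 1) * u j) / (u (j + 1) * a j)" for j
    using exp_ln_diff[of "u (j + 1) / a (j + 1)" "u j / a j" p] u(2) a(2) by (simp_all add: \<theta> mult_ac)
  have PQ: "P j + Q j = 2 * (a j * a (j + 1) * cosh (\<theta> j))" for j
    by (simp add: cosh_field_def exp_th P_def Q_def field_simps power2_eq_square)
  have "\<Lambda> * (\<Sum>j\<in>?I. (a j)\<^sup>2) = (\<Sum>j\<in>?I. V j * (a j)\<^sup>2) - 2 * d * (\<Sum>j\<in>?I. (a j)\<^sup>2)
      + d * (sum P ?I + (\<Sum>j\<in>?I. Q (j + (-1))))"
    by (simp add: sum_distrib_left pointwise sum.distrib sum_subtractf distrib_left del: add_uminus_conv_diff)
  also have "sum P ?I + (\<Sum>j\<in>?I. Q (j + (-1))) = (\<Sum>j\<in>?I. P j + Q j)"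
    by (simp add: sum_period_shift[OF N perQ] sum.distrib del: add_uminus_conv_diff)
  also have "\<dots> = 2 * (\<Sum>j\<in>?I. a j * a (j + 1) * cosh (\<theta> j))"
    by (simp add: PQ sum_distrib_left)
  finally show ?eq by simp
  have "periodic N (\<lambda>j. ln (u j / a j))" using u(1) a(1) by (simp add: periodic_def)
  from sum_period_shift[OF N this, of 1]
  show "(\<Sum>j\<in>?I. \<theta> j) = - (real N * p)"
    by (simp add: \<theta> sum_subtractf)
qed

text \<open>The exponents coming from the eigenvector are one admissible choice on each bond. Their
  prescribed sum turns the linear terms of \<open>legendre_le\<close> into the constant
  \<open>\<kappa> * (real N * p)\<close>.\<close>

lemma energy_le:
  assumes N: "N > 0" and d: "d > 0" and \<Lambda>: "is_principal_eigenvalue d N p V \<Lambda>"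
    and a: "periodic N a" "\<And>j. a j > 0"
  shows "energy d N p V \<kappa> a \<le> \<Lambda> * (\<Sum>j\<in>{0..<int N}. (a j)\<^sup>2)"
proof -
  let ?I = "{0..<int N}"
  obtain u where u: "periodic N u" "\<And>j. u j > 0" "\<And>j. tilted_op d p V u j = \<Lambda> * u j"
    using \<Lambda> unfolding is_principal_eigenvalue_def by auto
  define \<theta> where "\<theta> = (\<lambda>j. ln (u (j + 1) / a (j + 1)) - ln (u j / a j) - p)"
  note R = rayleigh_identity[OF N u a \<theta>_def]
  have "(\<Sum>j\<in>?I. legendre \<kappa> (a j * a (j + 1))) \<le> (\<Sum>j\<in>?I. a j * a (j + 1) * cosh (\<theta> j) - \<kappa> * \<theta> j)"
    using a(2) by (intro sum_mono legendre_le) simp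
  also have "\<dots> = (\<Sum>j\<in>?I. a j * a (j + 1) * cosh (\<theta> j)) + \<kappa> * (real N * p)"
    by (simp add: sum_subtractf sum_distrib_left[symmetric] R(2))
  finally have "(\<Sum>j\<in>?I. legendre \<kappa> (a j * a (j + 1))) - \<kappa> * (real N * p)
      \<le> (\<Sum>j\<in>?I. a j * a (j + 1) * cosh (\<theta> j))" by simp
  then show ?thesis using d unfolding energy_def R(1) by (intro add_left_mono mult_left_mono) simp_all
qed

text \<open>The operators for \<open>p\<close> and \<open>- p\<close> are transposes of each other.
  Pairing their positive eigenvectors makes the difference of the eigenvalues a telescoping sum over
  the cycle.\<close>

lemma is_principal_eigenvalue_uminus_eq:
  assumes N: "N > 0" and "is_principal_eigenvalue d N p V \<Lambda>" "is_principal_eigenvalue d N (- p) V \<Lambda>'"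
  shows "\<Lambda> = \<Lambda>'"
proof -
  let ?I = "{0..<int N}"
  obtain u where u: "periodic N u" "\<And>j. u j > 0" "\<And>j. tilted_op d p V u j = \<Lambda> * u j"
    using assms(2) unfolding is_principal_eigenvalue_def by auto
  obtain v where v: "periodic N v" "\<And>j. v j > 0" "\<And>j. tilted_op d (- p) V v j = \<Lambda>' * v j"
    using assms(3) unfolding is_principal_eigenvalue_def by auto
  define P where "P = (\<lambda>j. d * exp (- p) * v j * u (j + 1) - d * exp p * u j * v (j + 1))"
  have perP: "periodic N P"
    using periodicI_shift[OF u(1), of 1] periodicI_shift[OF v(1), of 1] u(1) v(1)
    by (simp add: periodic_def P_def)
  have "(\<Lambda> - \<Lambda>') * (u j * v j) = P j - P (j + (- 1))" for j
  proof -
    have "(\<Lambda> - \<Lambda>') * (u j * v j) = v j * (\<Lambda> * u j) - u j * (\<Lambda>' * v j)" by (simp add: algebra_simps)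
    also have "\<dots> = P j - P (j + (- 1))"
      unfolding u(3)[symmetric] v(3)[symmetric] by (simp add: tilted_op_def P_def algebra_simps)
    finally show ?thesis .
  qed
  then have "(\<Lambda> - \<Lambda>') * (\<Sum>j\<in>?I. u j * v j) = sum P ?I - (\<Sum>j\<in>?I. P (j + (- 1)))"
    by (simp add: sum_distrib_left sum_subtractf del: add_uminus_conv_diff)
  also have "\<dots> = 0" by (simp add: sum_period_shift[OF N perP] del: add_uminus_conv_diff)
  finally have "(\<Lambda> - \<Lambda>') * (\<Sum>j\<in>?I. u j * v j) = 0" .
  moreover have "(\<Sum>j\<in>?I. u j * v j) > 0" using N u(2) v(2) by (intro sum_pos) auto
  ultimately show ?thesis by simp
qed

text \<open>
  The optimal \<open>a\<close> is the geometric mean of the right and left eigenvectors; the flux \<open>\<kappa>\<close> between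
  neighbouring sites is constant because both vectors have the same eigenvalue.
\<close>

lemma energy_attained:
  assumes N: "N > 0" and d: "d > 0" and V: "periodic N V" and \<Lambda>: "is_principal_eigenvalue d N p V \<Lambda>"
  shows "\<exists>\<kappa> a. periodic N a \<and> (\<forall>j. a j > 0) \<and>
           energy d N p V \<kappa> a = \<Lambda> * (\<Sum>j\<in>{0..<int N}. (a j)\<^sup>2)"
proof -
  let ?I = "{0..<int N}"
  obtain \<Lambda>' where \<Lambda>': "is_principal_eigenvalue d N (- p) V \<Lambda>'"
    using is_principal_eigenvalue_exists[OF N d V] by blast
  have eq: "\<Lambda>' = \<Lambda>" using is_principal_eigenvalue_uminus_eq[OF N \<Lambda> \<Lambda>'] by simp
  obtain u where u: "periodic N u" "\<And>j. u j > 0" "\<And>j. tilted_op d p V u j = \<Lambda> * u j"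
    using \<Lambda> unfolding is_principal_eigenvalue_def by auto
  obtain v where v: "periodic N v" "\<And>j. v j > 0" "\<And>j. tilted_op d (- p) V v j = \<Lambda> * v j"
    using \<Lambda>' unfolding is_principal_eigenvalue_def eq by auto
  define a where "a = (\<lambda>j. sqrt (u j) * sqrt (v j))"
  have a: "periodic N a" "\<And>j. a j > 0" using u v by (simp_all add: a_def periodic_def)
  define \<theta> where "\<theta> = (\<lambda>j. ln (u (j + 1) / a (j + 1)) - ln (u j / a j) - p)"
  note R = rayleigh_identity[OF N u a \<theta>_def]
  define J where "J = (\<lambda>j. exp (- p) * v j * u (j + 1) - exp p * u j * v (j + 1))"
  have step: "J (j + 1) = J j" for j
  proof -
    \<comment> \<open>Cross-multiplying the two eigenvalue equations cancels the diagonal terms and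
      leaves equality of the fluxes through the two bonds at \<open>j + 1\<close>.\<close>
    have "v (j + 1) * tilted_op d p V u (j + 1) = u (j + 1) * tilted_op d (- p) V v (j + 1)"
      unfolding u(3) v(3) by simp
    then have "d * J (j + 1) = d * J j" by (simp add: tilted_op_def J_def algebra_simps)
    then show ?thesis using d by simp
  qed
  have J_const: "J j = J 0" for j
  proof (induction j rule: int_induct[where k = 0])
    case (step2 i)
    then show ?case using step[of "i - 1"] by simp
  qed (simp_all add: step)
  define \<kappa> where "\<kappa> = J 0 / 2"
  \<comment> \<open>This is the minimiser equation of \<open>legendre_eq\<close>, so the bond
    estimates of \<open>energy_le\<close> are equalities for this \<open>a\<close> and
    \<kappa>.\<close>
  have flux: "a j * a (j + 1) * sinh (\<theta> j) = \<kappa>" for j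
  proof -
    define x where "x = sqrt (u j)"
    define y where "y = sqrt (v j)"
    define x' where "x' = sqrt (u (j + 1))"
    define y' where "y' = sqrt (v (j + 1))"
    have pos: "x > 0" "y > 0" "x' > 0" "y' > 0" using u(2) v(2) by (simp_all add: x_def y_def x'_def y'_def)
    have sq: "u j = x\<^sup>2" "v j = y\<^sup>2" "u (j + 1) = x'\<^sup>2" "v (j + 1) = y'\<^sup>2"
      using u(2)[of j] v(2)[of j] u(2)[of "j + 1"] v(2)[of "j + 1"]
      by (simp_all add: x_def y_def x'_def y'_def less_imp_le)
    have as: "a j = x * y" "a (j + 1) = x' * y'" by (simp_all add: a_def x_def y_def x'_def y'_def)
    have "\<theta> j = ln (x' / y') - ln (x / y) - p"
      using pos by (simp add: \<theta>_def as sq power2_eq_square)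
    with exp_ln_diff[of "x' / y'" "x / y" p]
    have e: "exp (\<theta> j) = exp (- p) * x' * y / (y' * x)" "exp (- \<theta> j) = exp p * y' * x / (x' * y)"
      using pos by (simp_all add: mult_ac)
    have "a j * a (j + 1) * sinh (\<theta> j) = (exp (- p) * y\<^sup>2 * x'\<^sup>2 - exp p * x\<^sup>2 * y'\<^sup>2) / 2"
      using pos unfolding as sinh_field_def e by (simp add: field_simps power2_eq_square)
    also have "\<dots> = J j / 2" by (simp add: J_def sq)
    finally show ?thesis by (simp add: \<kappa>_def J_const[of j])
  qed
  have "(\<Sum>j\<in>?I. legendre \<kappa> (a j * a (j + 1))) = (\<Sum>j\<in>?I. a j * a (j + 1) * cosh (\<theta> j) - \<kappa> * \<theta> j)"
    using a(2) by (intro sum.cong refl legendre_eq flux) simp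
  also have "\<dots> = (\<Sum>j\<in>?I. a j * a (j + 1) * cosh (\<theta> j)) + \<kappa> * (real N * p)"
    by (simp add: sum_subtractf sum_distrib_left[symmetric] R(2))
  finally have "energy d N p V \<kappa> a = \<Lambda> * (\<Sum>j\<in>?I. (a j)\<^sup>2)"
    unfolding energy_def R(1) by simp
  then show ?thesis using a by blast
qed

section \<open>Polarization\<close>

definition bell_rank :: "nat \<Rightarrow> int \<Rightarrow> nat" where
  "bell_rank N x = bell_order N ! nat (x mod int N)"

lemma filter_even_upt: "filter even [2..<N + 1] = map (\<lambda>k. 2 * k + 2) [0..<N div 2]"
proof (induction N)
  case (Suc N)
  show ?case
  proof (cases "N = 0")
    case False
    then show ?thesis using Suc by (cases "even N") (auto elim!: evenE oddE)
  qed simp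
qed simp

lemma filter_odd_upt: "filter odd [2..<N + 1] = map (\<lambda>k. 2 * k + 3) [0..<(N - 1) div 2]"
proof (induction N)
  case (Suc N)
  consider "N = 0" | "odd N" | b where "N = 2 * Suc b"
    by (metis evenE not0_implies_Suc mult_0_right)
  then show ?case using Suc by cases (auto elim!: oddE)
qed simp

text \<open>From site 0, which has rank 1, the ranks are 2, 4, ... to the right and 3, 5, ... to the
  left. The closed form reduces comparisons of ranks to linear integer arithmetic.\<close>

lemma bell_rank_eq:
  assumes N: "N > 0" and m: "m = x mod int N"
  shows "int (bell_rank N x) = (if m = 0 then 1 else if 2 * m \<le> int N then 2 * m else 2 * (int N - m) + 1)"
proof -
  have m0: "0 \<le> m" "m < int N" using N by (simp_all add: m)
  define n where "n = nat m"
  have mn: "m = int n" "n < N" using m0 by (simp_all add: n_def)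
  show ?thesis
  proof (cases n)
    case 0
    then show ?thesis using mn by (simp add: bell_rank_def bell_order_def m[symmetric])
  next
    case (Suc k)
    have half: "(N - 1) div 2 + N div 2 = N - 1" by presburger
    have "bell_rank N x = (filter even [2..<N + 1] @ rev (filter odd [2..<N + 1])) ! k"
      using Suc mn by (simp add: bell_rank_def bell_order_def m[symmetric] nat_add_distrib del: upt_Suc)
    also have "\<dots> = (if k < N div 2 then 2 * k + 2 else 2 * ((N - 1) div 2 - Suc (k - N div 2)) + 3)"
    proof (cases "k < N div 2")
      case True
      then show ?thesis unfolding filter_even_upt by (simp add: nth_append)
    next
      case False
      then have lt: "k - N div 2 < (N - 1) div 2" using mn Suc half by linarith
      have nth: "rev (map (\<lambda>k. 2 * k + 3) [0..<q]) ! i = 2 * (q - Suc i) + 3" if "i < q" for q i :: nat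
        using that by (simp add: rev_nth)
      show ?thesis unfolding filter_even_upt filter_odd_upt nth_append
        by (simp only: length_map length_upt diff_zero False if_False nth[OF lt])
    qed
    finally have "bell_rank N x = (if k < N div 2 then 2 * k + 2 else 2 * (N - 2 - k) + 3)"
      using half mn Suc by (auto split: if_splits)
    then show ?thesis using mn Suc by auto
  qed
qed

lemma bell_rank_bounds:
  assumes "N > 0"
  shows "1 \<le> bell_rank N x" "bell_rank N x \<le> N"
proof -
  have "0 \<le> x mod int N" "x mod int N < int N" using assms by simp_all
  then show "1 \<le> bell_rank N x" "bell_rank N x \<le> N"
    using bell_rank_eq[OF assms refl, of x] by (auto split: if_splits)
qed

lemma periodic_bell_rank: "periodic N (bell_rank N)"
  by (simp add: periodic_def bell_rank_def)

lemma bell_rank_inject: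
  assumes N: "N > 0" and eq: "bell_rank N x = bell_rank N y"
  shows "x mod int N = y mod int N"
proof -
  define m where "m = x mod int N"
  define k where "k = y mod int N"
  have "0 \<le> m" "m < int N" "0 \<le> k" "k < int N" using N by (simp_all add: m_def k_def)
  moreover have "(if m = 0 then 1 else if 2 * m \<le> int N then 2 * m else 2 * (int N - m) + 1)
      = (if k = 0 then 1 else if 2 * k \<le> int N then 2 * k else 2 * (int N - k) + 1)"
    using bell_rank_eq[OF N m_def] bell_rank_eq[OF N k_def] eq by simp
  \<comment> \<open>Parity separates the two sides of site 0.\<close>
  moreover have "2 * a \<noteq> 2 * b + 1" for a b :: int by presburger
  note this[of m "int N - k"] this[of k "int N - m"] this[of m 0] this[of k 0]
  ultimately have "m = k" by (smt (verit))
  then show ?thesis by (simp add: m_def k_def)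
qed

text \<open>
  The ranks increase with the distance to the point \<open>1/4\<close> of the cycle, so \<open>x\<close> precedes its mirror
  image exactly on one of the two arcs cut out by the axis; neighbours on different arcs are mirror
  images of each other.
\<close>

lemma bell_rank_cross:
  assumes N: "N > 0"
    and "bell_rank N x < bell_rank N (s - x) \<and> bell_rank N (s - (x + 1)) < bell_rank N (x + 1) \<or>
         bell_rank N (s - x) < bell_rank N x \<and> bell_rank N (x + 1) < bell_rank N (s - (x + 1))"
  shows "(x + 1) mod int N = (s - x) mod int N"
proof -
  define m where "m = x mod int N"
  define k where "k = (s - x) mod int N"
  define m' where "m' = (x + 1) mod int N"
  define k' where "k' = (s - (x + 1)) mod int N"
  have mk: "0 \<le> m" "m < int N" "0 \<le> k" "k < int N" using N by (simp_all add: m_def k_def)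
  have "m' = (m + 1) mod int N" "k' = (k - 1) mod int N"
    by (simp_all add: m_def m'_def k_def k'_def mod_simps algebra_simps)
  then have m': "m' = (if m = int N - 1 then 0 else m + 1)" and k': "k' = (if k = 0 then int N - 1 else k - 1)"
    using mk by (auto simp: zmod_minus1 intro: mod_pos_pos_trivial)
  define f where "f i = (if i = 0 then 1 else if 2 * i \<le> int N then 2 * i else 2 * (int N - i) + 1)" for i :: int
  have "f m < f k \<and> f k' < f m' \<or> f k < f m \<and> f m' < f k'"
    using assms(2) bell_rank_eq[OF N m_def] bell_rank_eq[OF N k_def] bell_rank_eq[OF N m'_def]
      bell_rank_eq[OF N k'_def] unfolding f_def by linarith
  then have "m' = k" using mk unfolding f_def m' k' by (smt (verit))
  then show ?thesis by (simp add: m'_def k_def)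
qed

text \<open>Two-point rearrangement; the centre of the reflection is a site for even
  \<open>s\<close> and the midpoint of a bond for odd \<open>s\<close>. Equal ranks mean that
  \<open>x\<close> and \<open>s - x\<close> are the same point of the cycle, so for periodic
  \<open>a\<close> a tie makes no difference.\<close>

definition polarize :: "nat \<Rightarrow> int \<Rightarrow> (int \<Rightarrow> 'a::linorder) \<Rightarrow> (int \<Rightarrow> 'a)" where
  "polarize N s a = (\<lambda>x. if bell_rank N x \<le> bell_rank N (s - x) then max (a x) (a (s - x)) else min (a x) (a (s - x)))"

lemma periodic_polarize:
  assumes "periodic N a"
  shows "periodic N (polarize N s a)"
  using periodicI_reflect[OF assms, of s] periodicI_reflect[OF periodic_bell_rank[of N], of s]
    assms periodic_bell_rank[of N]
  by (simp add: periodic_def polarize_def)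

lemma polarize_cases:
  assumes N: "N > 0" and a: "periodic N a"
  obtains
    (less) "bell_rank N x < bell_rank N (s - x)" "polarize N s a x = max (a x) (a (s - x))"
      "polarize N s a (s - x) = min (a x) (a (s - x))"
  | (greater) "bell_rank N (s - x) < bell_rank N x" "polarize N s a x = min (a x) (a (s - x))"
      "polarize N s a (s - x) = max (a x) (a (s - x))"
  | (eq) "bell_rank N x = bell_rank N (s - x)" "a (s - x) = a x" "polarize N s a x = a x"
      "polarize N s a (s - x) = a x"
proof (cases "bell_rank N x = bell_rank N (s - x)")
  case True
  then have "a x = a (s - x)" by (intro periodic_cong_mod[OF a] bell_rank_inject[OF N])
  then show ?thesis using True by (intro eq) (simp_all add: polarize_def)
next
  case False
  then show ?thesis using less greater
    by (cases "bell_rank N x < bell_rank N (s - x)") (auto simp: polarize_def max.commute min.commute)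
qed

text \<open>Doubling turns a sum over sites into one over mirror pairs without choosing a half of
  the cycle or singling out the points on the axis.\<close>

lemma double_sum_reflect:
  fixes G :: "int \<Rightarrow> 'a::comm_semiring_1"
  assumes "N > 0" "periodic N G"
  shows "2 * sum G {0..<int N} = (\<Sum>x\<in>{0..<int N}. G x + G (s - x))"
  using sum_period_reflect[OF assms, of s] by (simp add: sum.distrib mult_2)

text \<open>Polarization only permutes the values within each mirror pair. Real \<open>f\<close>
  gives the norm of \<open>a\<close>, and \<open>f\<close> with values in \<open>nat\<close> gives
  the multiset of entries.\<close>

lemma sum_polarize:
  fixes f :: "'a::linorder \<Rightarrow> 'b::linordered_semidom"
  assumes N: "N > 0" and a: "periodic N a"
  shows "(\<Sum>x\<in>{0..<int N}. f (polarize N s a x)) = (\<Sum>x\<in>{0..<int N}. f (a x))"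
proof -
  have per: "periodic N (\<lambda>x. f (polarize N s a x))" "periodic N (\<lambda>x. f (a x))"
    using periodic_polarize[OF a] a by (simp_all add: periodic_def)
  have "f (polarize N s a x) + f (polarize N s a (s - x)) = f (a x) + f (a (s - x))" for x
    by (rule polarize_cases[OF N a, of x s]) (auto simp: max_def min_def add.commute)
  then have "2 * (\<Sum>x\<in>{0..<int N}. f (polarize N s a x)) = 2 * (\<Sum>x\<in>{0..<int N}. f (a x))"
    unfolding double_sum_reflect[OF N per(1), of s] double_sum_reflect[OF N per(2), of s] by simp
  \<comment> \<open>The factor 2 is cancelled by strict monotonicity of addition, as the semiring
    has no division.\<close>
  then show ?thesis by (metis add_strict_mono less_irrefl linorder_less_linear mult_2)
qed

lemma polarize_pos:
  fixes a :: "int \<Rightarrow> real"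
  assumes "\<And>x. a x > 0"
  shows "polarize N s a x > 0"
  using assms by (simp add: polarize_def less_max_iff_disj)

text \<open>On each mirror pair \<open>V\<close> and the square of \<open>a\<close> become ordered
  the same way, so the two-term rearrangement inequality applies.\<close>

lemma sum_mult_square_le_polarize:
  fixes a V :: "int \<Rightarrow> real"
  assumes N: "N > 0" and a: "periodic N a" "\<And>x. a x > 0" and V: "periodic N V"
  shows "(\<Sum>x\<in>{0..<int N}. V x * (a x)\<^sup>2)
      \<le> (\<Sum>x\<in>{0..<int N}. polarize N s V x * (polarize N s a x)\<^sup>2)"
proof -
  let ?V = "polarize N s V" and ?a = "polarize N s a"
  have pair: "v * q\<^sup>2 + v' * q'\<^sup>2 \<le> max v v' * (max q q')\<^sup>2 + min v v' * (min q q')\<^sup>2"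
    if "q > 0" "q' > 0" for v v' q q' :: real
  proof -
    have "(v - v') * (q\<^sup>2 - q'\<^sup>2) \<le> 0" if "v \<le> v' \<and> q' \<le> q \<or> v' \<le> v \<and> q \<le> q'"
      using that \<open>q > 0\<close> \<open>q' > 0\<close> by (auto simp: mult_le_0_iff intro: power_mono)
    then show ?thesis by (auto simp: max_def min_def algebra_simps)
  qed
  have "V x * (a x)\<^sup>2 + V (s - x) * (a (s - x))\<^sup>2 \<le> ?V x * (?a x)\<^sup>2 + ?V (s - x) * (?a (s - x))\<^sup>2" for x
    by (rule polarize_cases[OF N a(1), of x s]; rule polarize_cases[OF N V, of x s])
      (use pair[OF a(2) a(2), of "V x" x "V (s - x)" "s - x"] in \<open>simp_all add: add.commute\<close>)
  then have "(\<Sum>x\<in>{0..<int N}. V x * (a x)\<^sup>2 + V (s - x) * (a (s - x))\<^sup>2)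
      \<le> (\<Sum>x\<in>{0..<int N}. ?V x * (?a x)\<^sup>2 + ?V (s - x) * (?a (s - x))\<^sup>2)" by (rule sum_mono)
  moreover have "periodic N (\<lambda>x. V x * (a x)\<^sup>2)" "periodic N (\<lambda>x. ?V x * (?a x)\<^sup>2)"
    using a(1) V periodic_polarize[OF a(1)] periodic_polarize[OF V] by (simp_all add: periodic_def)
  note this[THEN double_sum_reflect[OF N], of s]
  ultimately show ?thesis by linarith
qed

text \<open>Each bond is compared together with its mirror bond. If its ends lie on the same side of
  the axis, supermodularity applies; a bond crossing the axis is its own mirror image, and its
  product is unchanged.\<close>

lemma sum_legendre_le_polarize:
  fixes a :: "int \<Rightarrow> real"
  assumes N: "N > 0" and a: "periodic N a" "\<And>x. a x > 0"
  shows "(\<Sum>x\<in>{0..<int N}. legendre \<kappa> (a x * a (x + 1)))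
      \<le> (\<Sum>x\<in>{0..<int N}. legendre \<kappa> (polarize N s a x * polarize N s a (x + 1)))"
proof -
  let ?a = "polarize N s a"
  let ?G = "\<lambda>a x. legendre \<kappa> (a x * a (x + 1))"
  have double: "2 * (\<Sum>x\<in>{0..<int N}. ?G b x)
      = (\<Sum>x\<in>{0..<int N}. legendre \<kappa> (b x * b (x + 1)) + legendre \<kappa> (b (s - x) * b (s - (x + 1))))"
    if b: "periodic N b" for b
  proof -
    have "periodic N (?G b)" using b periodicI_shift[OF b, of 1] by (simp add: periodic_def)
    \<comment> \<open>Bonds are indexed by their left ends, and the mirror of the bond at
      \<open>x\<close> has left end \<open>s - (x + 1)\<close>.\<close>
    from sum_period_reflect[OF N this, of "s - 1"]
    have "(\<Sum>x\<in>{0..<int N}. ?G b (s - 1 - x)) = sum (?G b) {0..<int N}" .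
    moreover have "?G b (s - 1 - x) = legendre \<kappa> (b (s - x) * b (s - (x + 1)))" for x
      by (simp add: algebra_simps)
    ultimately show ?thesis by (simp add: sum.distrib)
  qed
  have pair: "legendre \<kappa> (p * q) + legendre \<kappa> (p' * q')
      \<le> legendre \<kappa> (max p p' * max q q') + legendre \<kappa> (min p p' * min q q')"
    if "p > 0" "p' > 0" "q > 0" "q' > 0" for p p' q q' :: real
    using that legendre_supermodular[of p p' q q' \<kappa>] legendre_supermodular[of p' p q' q \<kappa>]
      legendre_supermodular[of p p' q' q \<kappa>] legendre_supermodular[of p' p q q' \<kappa>]
    by (auto simp: max_def min_def)
  have "legendre \<kappa> (a x * a (x + 1)) + legendre \<kappa> (a (s - x) * a (s - (x + 1)))
      \<le> legendre \<kappa> (?a x * ?a (x + 1)) + legendre \<kappa> (?a (s - x) * ?a (s - (x + 1)))" for x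
  proof -
    define y where "y = x + 1"
    have mirror: "a y = a (s - x) \<and> a (s - y) = a x \<and> ?a y = ?a (s - x) \<and> ?a (s - y) = ?a x"
      if "bell_rank N x < bell_rank N (s - x) \<and> bell_rank N (s - y) < bell_rank N y \<or>
         bell_rank N (s - x) < bell_rank N x \<and> bell_rank N y < bell_rank N (s - y)"
    proof -
      have yx: "y mod int N = (s - x) mod int N"
        using bell_rank_cross[OF N, of x s] that by (simp add: y_def)
      then have "(s - y) mod int N = x mod int N"
        by (metis mod_diff_right_eq diff_diff_eq2 add_diff_cancel_left')
      then show ?thesis using yx
        by (auto intro!: periodic_cong_mod[OF a(1)] periodic_cong_mod[OF periodic_polarize[OF a(1)]])
    qed
    have max_min: "max u v * min u v = u * v" for u v :: real
      by (simp add: max_def min_def)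
    show ?thesis unfolding y_def[symmetric]
      by (rule polarize_cases[OF N a(1), of x s]; rule polarize_cases[OF N a(1), of y s])
        (use pair[of "a x" "a (s - x)" "a y" "a (s - y)"] mirror a(2) in
          \<open>simp_all add: add.commute mult.commute max_min\<close>)
  qed
  then have "2 * sum (?G a) {0..<int N} \<le> 2 * sum (?G ?a) {0..<int N}"
    unfolding double[OF a(1)] double[OF periodic_polarize[OF a(1)]] by (rule sum_mono)
  then show ?thesis by simp
qed

text \<open>The optimal \<open>a\<close> for \<open>V\<close>, polarized, is a trial vector for the
  polarized \<open>V\<close>, with the same \<kappa> and the same norm.\<close>

lemma principal_eigenvalue_le_polarize:
  assumes N: "N > 0" and d: "d > 0" and V: "periodic N V"
  shows "principal_eigenvalue d N p V \<le> principal_eigenvalue d N p (polarize N s V)"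
proof -
  let ?V = "polarize N s V" and ?I = "{0..<int N}"
  note ev = is_principal_eigenvalue_principal_eigenvalue[OF N d]
  obtain \<kappa> a where a: "periodic N a" "\<And>j. a j > 0"
    and E: "energy d N p V \<kappa> a = principal_eigenvalue d N p V * (\<Sum>j\<in>?I. (a j)\<^sup>2)"
    using energy_attained[OF N d V ev[OF V]] by blast
  have sq: "(\<Sum>j\<in>?I. (polarize N s a j)\<^sup>2) = (\<Sum>j\<in>?I. (a j)\<^sup>2)"
    by (rule sum_polarize[OF N a(1)])
  have "energy d N p V \<kappa> a \<le> energy d N p ?V \<kappa> (polarize N s a)"
    unfolding energy_def sq using d
    by (intro add_mono diff_right_mono mult_left_mono[of _ _ "2 * d"]
        sum_mult_square_le_polarize[OF N a V] sum_legendre_le_polarize[OF N a]) simp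
  also have "\<dots> \<le> principal_eigenvalue d N p ?V * (\<Sum>j\<in>?I. (a j)\<^sup>2)"
    unfolding sq[symmetric] by (intro energy_le[OF N d] ev periodic_polarize V a(1) polarize_pos a(2))
  finally have "principal_eigenvalue d N p V * (\<Sum>j\<in>?I. (a j)\<^sup>2)
      \<le> principal_eigenvalue d N p ?V * (\<Sum>j\<in>?I. (a j)\<^sup>2)" unfolding E .
  moreover have "(\<Sum>j\<in>?I. (a j)\<^sup>2) > 0"
    using N a(2) by (intro sum_pos) (auto simp: less_imp_neq[symmetric])
  ultimately show ?thesis by simp
qed

section \<open>Reaching the bell order by polarizations\<close>

lemma count_image_mset_set:
  assumes "finite A"
  shows "count (image_mset f (mset_set A)) c = (\<Sum>x\<in>A. if f x = c then 1 else 0)"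
  using assms by (induction A) auto

lemma same_multisetI:
  assumes "periodic N W"
    and "\<And>f :: real \<Rightarrow> nat. (\<Sum>x\<in>{0..<int N}. f (W x)) = (\<Sum>x\<in>{0..<int N}. f (V x))"
  shows "same_multiset N V W"
  unfolding same_multiset_def using assms(1) assms(2)[of "\<lambda>v. if v = c then 1 else 0" for c]
  by (auto intro!: multiset_eqI simp: count_image_mset_set)

lemma same_multiset_trans: "same_multiset N U V \<Longrightarrow> same_multiset N V W \<Longrightarrow> same_multiset N U W"
  by (simp add: same_multiset_def)

lemma same_multiset_polarize: "N > 0 \<Longrightarrow> periodic N V \<Longrightarrow> same_multiset N V (polarize N s V)"
  by (intro same_multisetI periodic_polarize sum_polarize)

lemma same_multiset_image:
  assumes "same_multiset N V W"
  shows "W ` {0..<int N} = V ` {0..<int N}"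
  using assms unfolding same_multiset_def by (metis finite_atLeastLessThan_int finite_set_mset_mset_set set_image_mset)

text \<open>Finiteness will provide a minimiser, in place of an explicit sorting procedure.\<close>

lemma finite_same_multiset:
  assumes "N > 0"
  shows "finite {W. same_multiset N V W}"
proof (rule finite_subset)
  let ?I = "{0..<int N}"
  show "{W. same_multiset N V W} \<subseteq> (\<lambda>h j. h (j mod int N)) ` PiE ?I (\<lambda>_. V ` ?I)"
  proof
    fix W assume "W \<in> {W. same_multiset N V W}"
    then have W: "same_multiset N V W" by simp
    then have "W = (\<lambda>j. restrict W ?I (j mod int N))"
      using assms periodic_mod[of N W] by (simp add: same_multiset_def fun_eq_iff)
    moreover have "restrict W ?I \<in> PiE ?I (\<lambda>_. V ` ?I)"
      using same_multiset_image[OF W] by auto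
    ultimately show "W \<in> (\<lambda>h j. h (j mod int N)) ` PiE ?I (\<lambda>_. V ` ?I)" by blast
  qed
qed (intro finite_imageI finite_PiE; simp)

text \<open>Read in the order of ranks, \<open>W\<close> is a decreasing list of the entries of
  \<open>V\<close>, and such a list is unique. The weak inequality in \<open>mono\<close> allows
  repeated values.\<close>

lemma eq_bell_rearrangement:
  assumes N: "N > 0" and W: "same_multiset N V W"
    and mono: "\<And>i j. bell_rank N i < bell_rank N j \<Longrightarrow> W j \<le> W i"
  shows "W = bell_rearrangement N V"
proof
  fix j
  \<comment> \<open>Ranks start at 1, list positions at 0.\<close>
  let ?I = "{0..<int N}" and ?r = "\<lambda>x. bell_rank N x - 1"
  have per: "periodic N W" using W by (simp add: same_multiset_def)
  have inj: "inj_on ?r ?I"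
  proof (rule inj_onI)
    fix x y assume xy: "x \<in> ?I" "y \<in> ?I" "?r x = ?r y"
    then have "bell_rank N x = bell_rank N y"
      using bell_rank_bounds(1)[OF N, of x] bell_rank_bounds(1)[OF N, of y] by linarith
    then show "x = y" using bell_rank_inject[OF N, of x y] xy by simp
  qed
  have "?r ` ?I = {0..<N}"
  proof (rule card_subset_eq)
    show "?r ` ?I \<subseteq> {0..<N}"
    proof
      fix i assume "i \<in> ?r ` ?I"
      then obtain x where "i = ?r x" by blast
      then show "i \<in> {0..<N}" using bell_rank_bounds[OF N, of x] by simp
    qed
    show "card (?r ` ?I) = card {0..<N}" using card_image[OF inj] by simp
  qed simp
  then have bij: "bij_betw ?r ?I {0..<N}" using inj by (simp add: bij_betw_def)
  define q where "q = inv_into ?I ?r"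
  have bij_q: "bij_betw q {0..<N} ?I" unfolding q_def by (rule bij_betw_inv_into[OF bij])
  have rq: "?r (q k) = k" if "k < N" for k
    using bij_betw_inv_into_right[OF bij, of k] that by (simp add: q_def)
  define D where "D = map (\<lambda>k. W (q k)) [0..<N]"
  have "sorted (rev D)"
  proof -
    have "W (q k) \<le> W (q i)" if "i \<le> k" "k < N" for i k
    proof (cases "i = k")
      case False
      then have "?r (q i) < ?r (q k)" using rq that by simp
      then show ?thesis by (intro mono) simp
    qed simp
    then show ?thesis by (auto simp: D_def sorted_rev_iff_nth_mono)
  qed
  moreover have "mset (rev D) = mset (map V [0..int N - 1])"
  proof -
    have "mset D = image_mset (W \<circ> q) (mset_set {0..<N})" by (simp add: D_def o_def)
    also have "\<dots> = image_mset W (image_mset q (mset_set {0..<N}))"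
      by (simp add: multiset.map_comp)
    also have "image_mset q (mset_set {0..<N}) = mset_set ?I"
      using bij_q by (simp add: image_mset_mset_set bij_betw_def)
    also have "image_mset W (mset_set ?I) = image_mset V (mset_set ?I)"
      using W by (simp add: same_multiset_def)
    also have "?I = set [0..int N - 1]" by auto
    finally show ?thesis by (simp only: mset_set_set distinct_upto mset_map mset_rev)
  qed
  ultimately have "sort (map V [0..int N - 1]) = rev D"
    by (intro properties_for_sort)
  then have "decreasing_entries N V = D" by (simp add: decreasing_entries_def)
  then have "bell_rearrangement N V j = D ! ?r j"
    by (simp add: bell_rearrangement_def bell_rank_def)
  also have "\<dots> = W (q (?r j))"
  proof -
    have "?r j < N" using bell_rank_bounds[OF N, of j] by linarith
    then show ?thesis by (simp add: D_def)
  qed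
  also have "\<dots> = W j"
  proof (rule periodic_cong_mod[OF per], rule bell_rank_inject[OF N])
    have "?r j < N" using bell_rank_bounds[OF N, of j] by simp
    then have "?r (q (?r j)) = ?r j" by (rule rq)
    then show "bell_rank N (q (?r j)) = bell_rank N j"
      using bell_rank_bounds(1)[OF N, of j] bell_rank_bounds(1)[OF N, of "q (?r j)"] by linarith
  qed
  finally show "W j = bell_rearrangement N V j" ..
qed

text \<open>
  A polarization that moves anything strictly decreases the sum of \<open>bell_rank N x * W x\<close>, and an
  inversion at \<open>i\<close>, \<open>j\<close> is removed by the reflection exchanging \<open>i\<close> and \<open>j\<close>.
\<close>

lemma bell_rearrangement_polarize_induct:
  assumes N: "N > 0" and V: "periodic N V" and "P V"
    and step: "\<And>W s. same_multiset N V W \<Longrightarrow> P W \<Longrightarrow> P (polarize N s W)"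
  shows "P (bell_rearrangement N V)" and "same_multiset N V (bell_rearrangement N V)"
proof -
  let ?I = "{0..<int N}"
  \<comment> \<open>Minimising only over rearrangements that satisfy \<open>P\<close> avoids
    recording a chain of polarizations: \<open>step\<close> keeps the polarized minimiser in
    \<open>S\<close>.\<close>
  define S where "S = {W. same_multiset N V W \<and> P W}"
  define m where "m W = (\<Sum>x\<in>?I. real (bell_rank N x) * W x)" for W
  have "finite S" unfolding S_def by (rule finite_subset[OF _ finite_same_multiset[OF N, of V]]) auto
  moreover have "V \<in> S" using V \<open>P V\<close> by (simp add: S_def same_multiset_def)
  ultimately obtain W where W: "W \<in> S" and min: "\<And>W'. W' \<in> S \<Longrightarrow> \<not> m W' < m W"
    using ex_min_if_finite[of "m ` S"] by fastforce
  have sm: "same_multiset N V W" and "P W" using W by (simp_all add: S_def)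
  then have per: "periodic N W" by (simp add: same_multiset_def)
  have "W = bell_rearrangement N V"
  proof (rule eq_bell_rearrangement[OF N sm], rule ccontr)
    fix i j assume ij: "bell_rank N i < bell_rank N j" "\<not> W j \<le> W i"
    define s where "s = i + j"
    define W' where "W' = polarize N s W"
    have per': "periodic N W'" unfolding W'_def by (rule periodic_polarize[OF per])
    have "W' \<in> S" unfolding S_def W'_def
      using same_multiset_trans[OF sm same_multiset_polarize[OF N per]] step[OF sm \<open>P W\<close>] by simp
    define G where "G U x = real (bell_rank N x) * U x" for U :: "int \<Rightarrow> real" and x
    have perG: "periodic N (G U)" if "periodic N U" for U
      using that periodic_bell_rank[of N] by (simp add: G_def periodic_def)
    define H where "H U x = G U x + G U (s - x)" for U x
    have perH: "periodic N (H U)" if "periodic N U" for U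
      using perG[OF that] periodicI_reflect[OF perG[OF that], of s] by (simp add: H_def periodic_def)
    have double: "2 * m U = sum (H U) ?I" if "periodic N U" for U
      using double_sum_reflect[OF N perG[OF that], of s] by (simp add: H_def G_def m_def)
    have swap: "r * v' + r' * v \<le> r * v + r' * v'" if "r \<le> r'" "v \<le> v'" for r r' v v' :: real
      using mult_nonneg_nonneg[of "r' - r" "v' - v"] that by (simp add: algebra_simps)
    \<comment> \<open>On each mirror pair polarization gives the larger value the smaller rank,
      which by \<open>swap\<close> cannot increase the weighted sum.\<close>
    have "H W' x \<le> H W x" for x
      unfolding H_def G_def W'_def
      by (rule polarize_cases[OF N per, of x s])
        (use swap[of "real (bell_rank N x)" "real (bell_rank N (s - x))" "W x" "W (s - x)"]
          swap[of "real (bell_rank N (s - x))" "real (bell_rank N x)" "W (s - x)" "W x"]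
          in \<open>auto simp: max_def min_def\<close>)
    moreover have "H W' (i mod int N) < H W (i mod int N)"
    proof -
      have ji: "s - i = j" by (simp add: s_def)
      have "W' i = W j" "W' j = W i"
        using ij by (simp_all add: W'_def polarize_def ji) (simp add: s_def)
      then have "H W i - H W' i = (real (bell_rank N j) - real (bell_rank N i)) * (W j - W i)"
        by (simp add: H_def G_def ji algebra_simps)
      also have "\<dots> > 0" using ij by simp
      finally show ?thesis by (simp add: periodic_mod[OF perH[OF per]] periodic_mod[OF perH[OF per']])
    qed
    moreover have "i mod int N \<in> ?I" using N by simp
    ultimately have "sum (H W') ?I < sum (H W) ?I"
      by (intro sum_strict_mono_ex1) auto
    then have "m W' < m W" using double[OF per] double[OF per'] by linarith
    then show False using min[OF \<open>W' \<in> S\<close>] by simp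
  qed
  then show "P (bell_rearrangement N V)" "same_multiset N V (bell_rearrangement N V)"
    using sm \<open>P W\<close> by simp_all
qed

section \<open>Monotonicity of the speed\<close>

lemma is_principal_eigenvalue_shift:
  assumes "is_principal_eigenvalue d N p V \<Lambda>"
  shows "is_principal_eigenvalue d N p (\<lambda>j. V (j + k)) \<Lambda>"
proof -
  obtain \<phi> where \<phi>: "periodic N \<phi>" "\<And>j. \<phi> j > 0" "\<And>j. tilted_op d p V \<phi> j = \<Lambda> * \<phi> j"
    using assms unfolding is_principal_eigenvalue_def by auto
  have "tilted_op d p (\<lambda>j. V (j + k)) (\<lambda>j. \<phi> (j + k)) j = \<Lambda> * \<phi> (j + k)" for j
    using \<phi>(3)[of "j + k"] by (simp add: tilted_op_def algebra_simps)
  then show ?thesis unfolding is_principal_eigenvalue_def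
    using periodicI_shift[OF \<phi>(1)] \<phi>(2) by (intro exI[of _ "\<lambda>j. \<phi> (j + k)"]) simp
qed

text \<open>Reflection exchanges the two neighbours of a site and hence their factors
  \<open>exp (- p)\<close> and \<open>exp p\<close>.\<close>

lemma is_principal_eigenvalue_reflect:
  assumes "is_principal_eigenvalue d N p V \<Lambda>"
  shows "is_principal_eigenvalue d N (- p) (\<lambda>j. V (k - j)) \<Lambda>"
proof -
  obtain \<phi> where \<phi>: "periodic N \<phi>" "\<And>j. \<phi> j > 0" "\<And>j. tilted_op d p V \<phi> j = \<Lambda> * \<phi> j"
    using assms unfolding is_principal_eigenvalue_def by auto
  have "tilted_op d (- p) (\<lambda>j. V (k - j)) (\<lambda>j. \<phi> (k - j)) j = \<Lambda> * \<phi> (k - j)" for j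
    using \<phi>(3)[of "k - j"] by (simp add: tilted_op_def algebra_simps)
  then show ?thesis unfolding is_principal_eigenvalue_def
    using periodicI_reflect[OF \<phi>(1)] \<phi>(2) by (intro exI[of _ "\<lambda>j. \<phi> (k - j)"]) simp
qed

lemma principal_eigenvalue_dihedral:
  assumes N: "N > 0" and d: "d > 0" and x: "periodic N x" and eq: "dihedral_equiv x y"
  shows "principal_eigenvalue d N p y = principal_eigenvalue d N p x"
proof -
  note ev = is_principal_eigenvalue_principal_eigenvalue[OF N d x]
  obtain k where "y = (\<lambda>j. x (j + k)) \<or> y = (\<lambda>j. x (k - j))"
    using eq unfolding dihedral_equiv_def by (auto simp: fun_eq_iff)
  then have "is_principal_eigenvalue d N p y (principal_eigenvalue d N p x)"
  proof
    assume "y = (\<lambda>j. x (j + k))"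
    then show ?thesis using is_principal_eigenvalue_shift[OF ev] by simp
  next
    assume "y = (\<lambda>j. x (k - j))"
    then have "is_principal_eigenvalue d N p y (principal_eigenvalue d N (- p) x)"
      using is_principal_eigenvalue_reflect[OF ev, of "- p" k] by simp
    then show ?thesis using is_principal_eigenvalue_uminus_eq[OF N ev ev] by simp
  qed
  then show ?thesis by (rule principal_eigenvalue_eqI[OF N d])
qed

lemma cstar_dihedral:
  assumes "N > 0" "d > 0" "periodic N x" "dihedral_equiv x y"
  shows "cstar d N y = cstar d N x"
  unfolding cstar_def principal_eigenvalue_dihedral[OF assms] ..

lemma same_multiset_dihedral:
  assumes N: "N > 0" and x: "periodic N x" and eq: "dihedral_equiv x y"
  shows "same_multiset N x y"
proof -
  obtain k where "y = (\<lambda>j. x (j + k)) \<or> y = (\<lambda>j. x (k - j))"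
    using eq unfolding dihedral_equiv_def by (auto simp: fun_eq_iff)
  then show ?thesis
  proof
    assume y: "y = (\<lambda>j. x (j + k))"
    have "(\<Sum>j\<in>{0..<int N}. f (x (j + k))) = (\<Sum>j\<in>{0..<int N}. f (x j))" for f :: "real \<Rightarrow> nat"
      using x by (intro sum_period_shift[OF N, of "\<lambda>j. f (x j)"]) (simp add: periodic_def)
    then show ?thesis unfolding y by (intro same_multisetI periodicI_shift x)
  next
    assume y: "y = (\<lambda>j. x (k - j))"
    have "(\<Sum>j\<in>{0..<int N}. f (x (k - j))) = (\<Sum>j\<in>{0..<int N}. f (x j))" for f :: "real \<Rightarrow> nat"
      using x by (intro sum_period_reflect[OF N, of "\<lambda>j. f (x j)"]) (simp add: periodic_def)
    then show ?thesis unfolding y by (intro same_multisetI periodicI_reflect x)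
  qed
qed

section \<open>Comparison with the bell order\<close>

lemma principal_eigenvalue_le_bell:
  assumes N: "N > 0" and d: "d > 0" and V: "periodic N V"
  shows "principal_eigenvalue d N p V \<le> principal_eigenvalue d N p (bell_rearrangement N V)"
proof (rule bell_rearrangement_polarize_induct(1)[OF N V])
  fix W s assume "same_multiset N V W" "principal_eigenvalue d N p V \<le> principal_eigenvalue d N p W"
  then show "principal_eigenvalue d N p V \<le> principal_eigenvalue d N p (polarize N s W)"
    using principal_eigenvalue_le_polarize[OF N d, of W p s] by (simp add: same_multiset_def)
qed simp

lemma same_multiset_bell:
  "N > 0 \<Longrightarrow> periodic N V \<Longrightarrow> same_multiset N V (bell_rearrangement N V)"
  using bell_rearrangement_polarize_induct(2)[of N V "\<lambda>_. True"] by simp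

lemma bell_rearrangement_cong:
  assumes "same_multiset N V W"
  shows "bell_rearrangement N W = bell_rearrangement N V"
proof -
  have "mset (map U [0..int N - 1]) = image_mset U (mset_set {0..<int N})" for U :: "int \<Rightarrow> real"
  proof -
    have "{0..<int N} = set [0..int N - 1]" by auto
    then show ?thesis by (simp only: mset_set_set distinct_upto mset_map)
  qed
  then have "mset (map W [0..int N - 1]) = mset (map V [0..int N - 1])"
    using assms by (simp add: same_multiset_def)
  then have "sort (map W [0..int N - 1]) = sort (map V [0..int N - 1])"
    by (intro properties_for_sort) simp_all
  then show ?thesis by (simp add: bell_rearrangement_def decreasing_entries_def)
qed

text \<open>With the constant trial vector 1 and \<kappa> = 0 the diffusion terms cancel, so the
  mean of \<open>V\<close> bounds the eigenvalue from below for every \<open>p\<close>.\<close>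

lemma sum_le_principal_eigenvalue:
  assumes N: "N > 0" and d: "d > 0" and V: "periodic N V"
  shows "sum V {0..<int N} \<le> principal_eigenvalue d N p V * real N"
  using energy_le[OF N d is_principal_eigenvalue_principal_eigenvalue[OF N d V], of "\<lambda>_. 1" p 0]
  by (simp add: energy_def legendre_def periodic_def)

text \<open>The comparison holds for each \<open>p\<close> separately. Nonnegative rates keep the
  quotients bounded below, as monotonicity of a real infimum requires.\<close>

lemma cstar_le_bell:
  assumes N: "N > 0" and d: "d > 0" and V: "periodic N V" "\<And>j. V j \<ge> 0"
  shows "cstar d N V \<le> cstar d N (bell_rearrangement N V)"
  unfolding cstar_def
proof (rule cINF_mono)
  have "principal_eigenvalue d N p V \<ge> 0" for p
    using sum_le_principal_eigenvalue[OF N d V(1), of p] sum_nonneg[of "{0..<int N}" V] V(2) N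
    by (meson mult_neg_pos not_le of_nat_0_less_iff order_trans)
  then show "bdd_below ((\<lambda>p. principal_eigenvalue d N p V / p) ` {0<..})"
    by (intro bdd_belowI2[of _ 0]) simp
  fix p :: real assume "p \<in> {0<..}"
  then show "\<exists>q\<in>{0<..}. principal_eigenvalue d N q V / q
      \<le> principal_eigenvalue d N p (bell_rearrangement N V) / p"
    using principal_eigenvalue_le_bell[OF N d V(1), of p]
    by (intro bexI[of _ p] divide_right_mono) auto
qed simp

section \<open>The dynamical speeds\<close>

text \<open>Periodicity of the rates comes from that of \<open>f\<close> by uniqueness of one-sided
  derivatives; positivity is read off from the KPP bounds at 1/2.\<close>

lemma kpp_nonlinearity_rates:
  assumes "kpp_nonlinearity N f V"
  shows "periodic N V" "V j > 0"
proof -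
  have f: "periodic N f" "\<And>j. (f j has_real_derivative V j) (at 0 within {0..1})"
    "\<And>j s. 0 < s \<Longrightarrow> s < 1 \<Longrightarrow> 0 < f j s \<and> f j s \<le> V j * s"
    using assms unfolding kpp_nonlinearity_def by auto
  have nontriv: "at (0::real) within {0..1} \<noteq> bot"
    by (simp add: trivial_limit_within islimpt_Icc)
  have "V (j + int N) = V j" for j
  proof -
    have "f (j + int N) = f j" using f(1) by (simp add: periodic_def)
    then show ?thesis using f(2)[of j] f(2)[of "j + int N"] nontriv
      unfolding has_field_derivative_iff by (metis tendsto_unique)
  qed
  then show "periodic N V" by (simp add: periodic_def)
  show "V j > 0" using f(3)[of "1 / 2" j] by simp
qed

lemma min_front_speed_eqI: "is_min_front_speed d N f c \<Longrightarrow> min_front_speed d N f = c"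
  unfolding min_front_speed_def is_min_front_speed_def by (intro the_equality) (auto intro: order_antisym)

text \<open>Between two distinct thresholds the same solution would have to be near 0 and near 1.
  For large times an integer lies between \<open>x * t\<close> and \<open>y * t\<close>, and there
  the two estimates with margin 1/2 contradict each other.\<close>

lemma is_spreading_speed_unique:
  assumes "is_spreading_speed d f a" "is_spreading_speed d f b"
  shows "a = b"
proof -
  have False if a: "is_spreading_speed d f a" and b: "is_spreading_speed d f b" and "a < b" for a b
  proof -
    define u0 :: "int \<Rightarrow> real" where "u0 = (\<lambda>j. if j = 0 then 1 else 0)"
    have "compact_datum u0" by (simp add: compact_datum_def u0_def)
    then obtain u where u: "\<And>c'. c' > a \<Longrightarrow> decays_ahead u c'" "\<And>c'. 0 < c' \<Longrightarrow> c' < b \<Longrightarrow> invades_behind u c'"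
      using a b unfolding is_spreading_speed_def by metis
    define x where "x = a + (b - a) / 3"
    define y where "y = a + 2 * (b - a) / 3"
    have "0 \<le> a" using a by (simp add: is_spreading_speed_def)
    then have xy: "a < x" "0 < x" "x < y" "0 < y" "y < b"
      using \<open>a < b\<close> by (simp_all add: x_def y_def field_simps)
    have "\<forall>\<^sub>F t in at_top. \<forall>j. real_of_int j \<ge> x * t \<longrightarrow> \<bar>u t j\<bar> < 1 / 2"
      using u(1)[OF xy(1)] unfolding decays_ahead_def by (elim allE[of _ "1 / 2"]) simp
    moreover have "\<forall>\<^sub>F t in at_top. \<forall>j. 0 \<le> j \<and> real_of_int j \<le> y * t \<longrightarrow> \<bar>u t j - 1\<bar> < 1 / 2"
      using u(2)[OF xy(4,5)] unfolding invades_behind_def by (elim allE[of _ "1 / 2"]) simp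
    moreover have "\<forall>\<^sub>F t in at_top. t \<ge> 1 / (y - x)" by (rule eventually_ge_at_top)
    ultimately have "\<forall>\<^sub>F t :: real in at_top. False"
    proof eventually_elim
      case (elim t)
      define j where "j = \<lceil>x * t\<rceil>"
      have "(y - x) * t \<ge> 1" using elim(3) xy(3) by (simp add: pos_divide_le_eq mult.commute)
      then have "real_of_int j \<ge> x * t" "real_of_int j \<le> y * t"
        unfolding j_def using ceiling_correct[of "x * t"] by (linarith, simp add: left_diff_distrib)
      moreover have "t > 0" using elim(3) xy(3) by (meson divide_pos_pos diff_gt_0_iff_gt less_le_trans zero_less_one)
      then have "x * t > 0" using xy(2) by simp
      then have "j \<ge> 0" unfolding j_def by linarith
      ultimately show ?case using elim(1)[rule_format, of j] elim(2)[rule_format, of j] by linarith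
    qed
    then show False by simp
  qed
  from this[OF assms] this[OF assms(2,1)] show ?thesis by (metis linorder_less_linear)
qed

lemma spreading_speed_eqI: "is_spreading_speed d f c \<Longrightarrow> spreading_speed d f = c"
  unfolding spreading_speed_def by (intro the_equality) (auto dest: is_spreading_speed_unique)

text \<open>Reordered rates belong to another equation, so the dynamical speeds are compared for two
  nonlinearities \<open>g\<close> and \<open>h\<close>, whose speeds depend only on their
  rates.\<close>

theorem corollary1p6:
  fixes N :: nat and d :: real and f :: "int \<Rightarrow> real \<Rightarrow> real" and V :: "int \<Rightarrow> real"
  assumes "N \<ge> 3" and "d > 0" and "kpp_nonlinearity N f V"
  shows "cstar d N (bell_rearrangement N V) \<ge> cstar d N V \<and>
         (\<forall>B W. is_bell_rearrangement N V B \<and> same_multiset N V W \<longrightarrow>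
            same_multiset N V B \<and> cstar d N W \<le> cstar d N B) \<and>
         (\<forall>B W g h. is_bell_rearrangement N V B \<and> same_multiset N V W \<and>
            kpp_nonlinearity N g W \<and> kpp_speeds_eq_cstar d N g W \<and>
            kpp_nonlinearity N h B \<and> kpp_speeds_eq_cstar d N h B \<longrightarrow>
            min_front_speed d N g \<le> min_front_speed d N h \<and>
            spreading_speed d g \<le> spreading_speed d h)"
proof -
  have N: "N > 0" using assms(1) by simp
  note V = kpp_nonlinearity_rates[OF assms(3)]
  have bell: "same_multiset N V (bell_rearrangement N V)" by (rule same_multiset_bell[OF N V(1)])
  then have bell_per: "periodic N (bell_rearrangement N V)" by (simp add: same_multiset_def)
  have main: "same_multiset N V B" "cstar d N W \<le> cstar d N B"
    if B: "is_bell_rearrangement N V B" and W: "same_multiset N V W" for B W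
  proof -
    have eq: "dihedral_equiv (bell_rearrangement N V) B" using B by (simp add: is_bell_rearrangement_def)
    show "same_multiset N V B"
      by (rule same_multiset_trans[OF bell same_multiset_dihedral[OF N bell_per eq]])
    have per: "periodic N W" using W by (simp add: same_multiset_def)
    \<comment> \<open>\<open>W\<close> takes the same values as \<open>V\<close>, all
      positive.\<close>
    have "W j \<ge> 0" for j
    proof -
      have "W (j mod int N) \<in> V ` {0..<int N}" using N same_multiset_image[OF W] by auto
      then show ?thesis using V(2) by (auto simp: periodic_mod[OF per] less_imp_le)
    qed
    from cstar_le_bell[OF N assms(2) per this]
    show "cstar d N W \<le> cstar d N B"
      by (simp add: bell_rearrangement_cong[OF W] cstar_dihedral[OF N assms(2) bell_per eq])
  qed
  moreover have "cstar d N V \<le> cstar d N (bell_rearrangement N V)"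
    by (rule cstar_le_bell[OF N assms(2) V(1)]) (simp add: V(2) less_imp_le)
  moreover have "min_front_speed d N g \<le> min_front_speed d N h \<and> spreading_speed d g \<le> spreading_speed d h"
    if "is_bell_rearrangement N V B" "same_multiset N V W"
      and g: "kpp_speeds_eq_cstar d N g W" and h: "kpp_speeds_eq_cstar d N h B" for B W g h
  proof -
    have "min_front_speed d N g = cstar d N W" "spreading_speed d g = cstar d N W"
      "min_front_speed d N h = cstar d N B" "spreading_speed d h = cstar d N B"
      using g h by (simp_all add: kpp_speeds_eq_cstar_def min_front_speed_eqI spreading_speed_eqI)
    then show ?thesis using main(2)[OF that(1,2)] by simp
  qed
  ultimately show ?thesis by blast
qed

end
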